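(* Let $0<\alpha<2$, $0<\beta\le1$, let $B_{\alpha,\beta}$ be grey Brownian motion, and for $\varepsilon>0$ set $Z_{\alpha,\beta,\varepsilon}(t)=\varepsilon^{-\alpha/2}\big(B_{\alpha,\beta}(t+\varepsilon)-B_{\alpha,\beta}(t)\big)$, $t\ge0$. 1. Almost surely, for any $t\in[0,1]$ and all $x\in\mathbb{R}$ with $x\ne0$, $$\lambda\{s\in[0,t]:\ Z_{\alpha,\beta,\varepsilon}(s)\le x\}\longrightarrow t\,F_{Y_\beta}(x)\qquad(\varepsilon\to0).$$ 2. Almost surely, for each interval $I\subset\mathbb{R}_+$ and all $x\in\mathbb{R}$, $$\lambda\{t\in I:\ Z_{\alpha,\beta,\varepsilon}(t)\le x\}\longrightarrow\lambda(I)\,F_{Y_\beta}(x)\qquad(\varepsilon\to0).$$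
   Context: $E_\beta(x)=\sum_{n\ge0}x^n/\Gamma(\beta n+1)$ is the Mittag-Leffler function. Let $Y_\beta\ge 0$ be a random variable whose law (with density $M_\beta$, the M-Wright function; for $\beta=1$ the law is the point mass at $1$) is determined by $\mathbb{E}(e^{-sY_\beta})=E_\beta(-s)$, $s\ge0$. Let $B_H$ be a standard fractional Brownian motion with Hurst parameter $H=\alpha/2$ and continuous paths, i.e. the centered Gaussian process with covariance $\frac12(t^{\alpha}+s^{\alpha}-|t-s|^{\alpha})$, independent of $Y_\beta$. Grey Brownian motion is taken in the representation $B_{\alpha,\beta}(t)=\sqrt{Y_\beta}\,B_H(t)$, $t\ge0$. $\lambda$ is Lebesgue measure. $F_\sigma$ denotes the distribution function of the centered Gaussian law with variance $\sigma$; thus $F_{Y_\beta}(x)$ is the (random) value at $x$ of the centered Gaussian distribution function with variance $Y_\beta(\omega)$. *)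

theory Defs
  imports "HOL-Probability.Probability"
begin

definition mittag_leffler :: "real \<Rightarrow> real \<Rightarrow> real" where
  "mittag_leffler \<beta> x = (\<Sum>n. x ^ n / Gamma (\<beta> * real n + 1))"

(* The parameter v is the variance, whereas normal_density expects the standard deviation.
   Variance 0 gives the point mass at m. *)
definition gaussian_law :: "real \<Rightarrow> real \<Rightarrow> real measure" where
  "gaussian_law m v =
     (if v = 0 then return borel m else density lborel (normal_density m (sqrt v)))"

definition centered_gaussian_cdf :: "real \<Rightarrow> real \<Rightarrow> real" where
  "centered_gaussian_cdf v x = cdf (gaussian_law 0 v) x"

definition gaussian_process ::
    "'a measure \<Rightarrow> real set \<Rightarrow> (real \<Rightarrow> 'a \<Rightarrow> real) \<Rightarrow> bool" where
  "gaussian_process M T X \<longleftrightarrow>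
     (\<forall>t\<in>T. X t \<in> borel_measurable M) \<and>
     (\<forall>J c. finite J \<longrightarrow> J \<subseteq> T \<longrightarrow>
        (\<exists>m v. v \<ge> 0 \<and> distr M borel (\<lambda>\<omega>. \<Sum>t\<in>J. c t * X t \<omega>) = gaussian_law m v))"

(* Only times t \<ge> 0 are constrained. The process is centered, so the expectation of
   B s * B t is the covariance; it is integrable because B s and B t are Gaussian. *)
definition fractional_brownian_motion ::
    "'a measure \<Rightarrow> real \<Rightarrow> (real \<Rightarrow> 'a \<Rightarrow> real) \<Rightarrow> bool" where
  "fractional_brownian_motion M H B \<longleftrightarrow>
     gaussian_process M {0..} B \<and>
     (\<forall>t\<ge>0. integral\<^sup>L M (B t) = 0) \<and>
     (\<forall>s\<ge>0. \<forall>t\<ge>0. integral\<^sup>L M (\<lambda>\<omega>. B s \<omega> * B t \<omega>) =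
        (t powr (2 * H) + s powr (2 * H) - \<bar>t - s\<bar> powr (2 * H)) / 2) \<and>
     (\<forall>\<omega>\<in>space M. continuous_on {0..} (\<lambda>t. B t \<omega>))"

(* The Laplace transform determines the law, with density the M-Wright function for
   \<beta> < 1 and the point mass at 1 for \<beta> = 1. *)
definition M_Wright_variable :: "'a measure \<Rightarrow> real \<Rightarrow> ('a \<Rightarrow> real) \<Rightarrow> bool" where
  "M_Wright_variable M \<beta> Y \<longleftrightarrow>
     Y \<in> borel_measurable M \<and>
     (\<forall>\<omega>\<in>space M. Y \<omega> \<ge> 0) \<and>
     (\<forall>s\<ge>0. integral\<^sup>L M (\<lambda>\<omega>. exp (- s * Y \<omega>)) = mittag_leffler \<beta> (- s))"

(* Independence of the sigma-algebras generated by Y and by the whole process (B t), t \<ge> 0.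
   The library's indep_var would require both variables to have the same value type. *)
definition independent_of_process ::
    "'a measure \<Rightarrow> ('a \<Rightarrow> real) \<Rightarrow> (real \<Rightarrow> 'a \<Rightarrow> real) \<Rightarrow> bool" where
  "independent_of_process M Y B \<longleftrightarrow>
     prob_space.indep_set M
       (sets (vimage_algebra (space M) Y borel))
       (sets (vimage_algebra (space M) (\<lambda>\<omega>. \<lambda>t\<in>{0..}. B t \<omega>)
          (\<Pi>\<^sub>M t\<in>{0::real..}. (borel :: real measure))))"

definition grey_brownian_motion ::
    "('a \<Rightarrow> real) \<Rightarrow> (real \<Rightarrow> 'a \<Rightarrow> real) \<Rightarrow> real \<Rightarrow> 'a \<Rightarrow> real" where
  "grey_brownian_motion Y B t \<omega> = sqrt (Y \<omega>) * B t \<omega>"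

definition normalized_increment ::
    "real \<Rightarrow> (real \<Rightarrow> 'a \<Rightarrow> real) \<Rightarrow> real \<Rightarrow> real \<Rightarrow> 'a \<Rightarrow> real" where
  "normalized_increment \<alpha> X \<epsilon> t \<omega> = \<epsilon> powr (- \<alpha> / 2) * (X (t + \<epsilon>) \<omega> - X t \<omega>)"

end

theory Submission
  imports Defs "HOL-Real_Asymp.Real_Asymp"
begin

text \<open>
  Since \<open>Z(t) = sqrt Y * Z\<^sub>B(t)\<close> with \<open>Z\<^sub>B\<close> the normalised increments of the fractional Brownian motion,
  the claim is pathwise equivalent to one about \<open>Z\<^sub>B\<close> at the level \<open>x / sqrt Y\<close> (the case \<open>Y = 0\<close> being
  trivial). The correlation of \<open>Z\<^sub>B(s)\<close> and \<open>Z\<^sub>B(t)\<close> depends on \<open>h = (t - s) / \<epsilon>\<close> only and is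
  \<open>O(h powr (\<alpha> - 2))\<close>, so time averages of \<open>cos (u Z\<^sub>B - \<theta>)\<close> and \<open>Z\<^sub>B\<^sup>2\<close> have variance bounded by a power of
  \<open>\<epsilon>\<close> and converge almost surely along \<open>\<epsilon> = n powr (-a)\<close> for large \<open>a\<close>. Only laws of single linear
  combinations of the process enter. The averages of \<open>Z\<^sub>B\<^sup>2\<close> make the empirical characteristic functions
  equi-Lipschitz, which passes from rational to all frequencies, and the Levy continuity theorem
  yields convergence of the empirical distribution functions along the grid. The paths are Hoelder
  of every order below \<open>\<alpha> / 2\<close>, so \<open>Z\<^sub>B\<close> at \<open>\<epsilon>\<close> is uniformly close to \<open>Z\<^sub>B\<close> at the next larger grid
  point, and monotonicity in \<open>x\<close> together with continuity of the limit gives convergence for all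
  \<open>\<epsilon> \<rightarrow> 0\<close>.
\<close>

section \<open>Centered Gaussian laws\<close>

text \<open>The exceptional null set may depend neither on \<open>x\<close>, \<open>T\<close> and
  the interval nor on \<epsilon>, while a variance bound controls only a sequence of \<epsilon>. A
  geometric grid would be too coarse: its gaps are of order \<epsilon>, over which a path Hoelder of
  order \<gamma> < \<alpha> / 2 may move by \<epsilon> powr \<gamma>, far more than the scale
  \<epsilon> powr (\<alpha> / 2). On the grid \<open>n powr (-a)\<close> the gaps are of order
  \<epsilon> powr (1 + 1 / a), and the rescaled error \<epsilon> powr ((1 + 1 / a) \<gamma> -
  \<alpha> / 2) vanishes as soon as a \<alpha> / 2 < (a + 1) \<gamma>. However large summability
  forces \<open>a\<close> to be, some \<gamma> < \<alpha> / 2 satisfies this, so \<open>a\<close> is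
  fixed first and \<gamma> afterwards. Mixed moments of two increments reduce to the laws of their
  sum and difference, by the product-to-sum formula for cosines and by polarisation for
  squares.\<close>

lemma gaussian_law_eq_distr:
  assumes "0 \<le> v"
  shows "gaussian_law m v = distr std_normal_distribution borel (\<lambda>x. m + sqrt v * x)"
proof (cases "v = 0")
  case True
  interpret real_distribution std_normal_distribution by (rule real_dist_normal_dist)
  show ?thesis
    using True by (simp add: gaussian_law_def distr_const)
next
  case False
  interpret real_distribution std_normal_distribution by (rule real_dist_normal_dist)
  have "distributed std_normal_distribution lborel (\<lambda>x. x) std_normal_density"
    by (simp add: distributed_def distr_id2)
  from normal_density_affine[OF this, of "sqrt v" m] False assms
  show ?thesis
    by (simp add: distributed_def gaussian_law_def cong: distr_cong)
qed

lemma std_normal_mean: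
  "integrable std_normal_distribution (\<lambda>x. x)"
  "(LINT x|std_normal_distribution. x) = 0"
  using integrable_std_normal_distribution_moment[of 1]
    integral_std_normal_distribution_moment_odd[of 1]
  by simp_all

lemma std_normal_cos_sin:
  "(LINT x|std_normal_distribution. cos (u * x)) = exp (- u\<^sup>2 / 2)"
  "(LINT x|std_normal_distribution. sin (u * x)) = 0"
proof -
  interpret real_distribution std_normal_distribution by (rule real_dist_normal_dist)
  have *: "complex_of_real (exp (- u\<^sup>2 / 2)) = (CLINT x|std_normal_distribution. iexp (u * x))"
    using char_std_normal_distribution by (simp add: fun_eq_iff char_def)
  have i: "integrable std_normal_distribution (\<lambda>x. iexp (u * x))"
    by (rule integrable_iexp) auto
  have "(LINT x|std_normal_distribution. Re (iexp (u * x))) = exp (- u\<^sup>2 / 2)"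
    by (subst integral_Re[OF i]) (simp only: *[symmetric] Re_complex_of_real)
  then show "(LINT x|std_normal_distribution. cos (u * x)) = exp (- u\<^sup>2 / 2)"
    by (simp add: Re_exp)
  have "(LINT x|std_normal_distribution. Im (iexp (u * x))) = 0"
    by (subst integral_Im[OF i]) (simp only: *[symmetric] Im_complex_of_real)
  then show "(LINT x|std_normal_distribution. sin (u * x)) = 0"
    by (simp add: Im_exp)
qed

text \<open>The phase \<theta> lets one statement serve both parts of a characteristic function: 0
  gives the cosine, \<open>pi / 2\<close> the sine.\<close>

lemma std_normal_cos_shift:
  "(LINT x|std_normal_distribution. cos (u * x - \<theta>)) = cos \<theta> * exp (- u\<^sup>2 / 2)"
proof -
  interpret real_distribution std_normal_distribution by (rule real_dist_normal_dist)
  have "integrable std_normal_distribution (\<lambda>x. cos (u * x))"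
    "integrable std_normal_distribution (\<lambda>x. sin (u * x))"
    by (auto intro!: integrable_const_bound[where B=1])
  then show ?thesis
    by (simp add: cos_diff std_normal_cos_sin)
qed

text \<open>Variance 0 has to be allowed, since the difference of two increments degenerates when
  their times coincide. The representation as an image of the standard normal law covers both cases
  at once.\<close>

definition centered_gaussian :: "'a measure \<Rightarrow> ('a \<Rightarrow> real) \<Rightarrow> real \<Rightarrow> bool" where
  "centered_gaussian M L v \<longleftrightarrow> 0 \<le> v \<and> L \<in> borel_measurable M \<and> distr M borel L = gaussian_law 0 v"

lemma centered_gaussian_integral:
  fixes g :: "real \<Rightarrow> real"
  assumes "centered_gaussian M L v" and [measurable]: "g \<in> borel_measurable borel"
  shows "integral\<^sup>L M (\<lambda>\<omega>. g (L \<omega>)) = (LINT x|std_normal_distribution. g (sqrt v * x))"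
    and "integrable M (\<lambda>\<omega>. g (L \<omega>)) \<longleftrightarrow> integrable std_normal_distribution (\<lambda>x. g (sqrt v * x))"
proof -
  have [measurable]: "L \<in> borel_measurable M" and d: "distr M borel L = distr std_normal_distribution borel (\<lambda>x. sqrt v * x)"
    using assms(1) gaussian_law_eq_distr[of v 0] by (auto simp: centered_gaussian_def)
  show "integral\<^sup>L M (\<lambda>\<omega>. g (L \<omega>)) = (LINT x|std_normal_distribution. g (sqrt v * x))"
    using arg_cong[OF d, of "\<lambda>N. integral\<^sup>L N g"] by (simp add: integral_distr)
  show "integrable M (\<lambda>\<omega>. g (L \<omega>)) \<longleftrightarrow> integrable std_normal_distribution (\<lambda>x. g (sqrt v * x))"
    using arg_cong[OF d, of "\<lambda>N. integrable N g"] by (simp add: integrable_distr_eq)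
qed

lemma centered_gaussian_moments:
  assumes "centered_gaussian M L v"
  shows "integral\<^sup>L M (\<lambda>\<omega>. L \<omega> ^ (2 * k)) = v ^ k * (fact (2 * k) / (2 ^ k * fact k))"
    and "integrable M (\<lambda>\<omega>. L \<omega> ^ j)"
proof -
  have v: "0 \<le> v" using assms by (simp add: centered_gaussian_def)
  show "integral\<^sup>L M (\<lambda>\<omega>. L \<omega> ^ (2 * k)) = v ^ k * (fact (2 * k) / (2 ^ k * fact k))"
    using v centered_gaussian_integral(1)[OF assms, of "\<lambda>x. x ^ (2 * k)"]
    by (simp add: power_mult_distrib std_normal_distribution_even_moments power_mult[of "sqrt v"])
  show "integrable M (\<lambda>\<omega>. L \<omega> ^ j)"
    using centered_gaussian_integral(2)[OF assms, of "\<lambda>x. x ^ j"] integrable_std_normal_distribution_moment[of j]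
    by (simp add: power_mult_distrib)
qed

lemma centered_gaussian_square:
  assumes "centered_gaussian M L v"
  shows "integral\<^sup>L M (\<lambda>\<omega>. (L \<omega>)\<^sup>2) = v" "integral\<^sup>L M (\<lambda>\<omega>. L \<omega> ^ 4) = 3 * v\<^sup>2"
    "integrable M (\<lambda>\<omega>. (L \<omega>)\<^sup>2)" "integrable M L"
  using centered_gaussian_moments(1)[OF assms, of 1] centered_gaussian_moments(1)[OF assms, of 2]
    centered_gaussian_moments(2)[OF assms, of 2] centered_gaussian_moments(2)[OF assms, of 1]
  by (simp_all add: fact_numeral)

lemma centered_gaussian_cos:
  assumes "centered_gaussian M L v"
  shows "integral\<^sup>L M (\<lambda>\<omega>. cos (u * L \<omega> - \<theta>)) = cos \<theta> * exp (- u\<^sup>2 * v / 2)"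
proof -
  have v: "0 \<le> v" using assms by (simp add: centered_gaussian_def)
  have "integral\<^sup>L M (\<lambda>\<omega>. cos (u * L \<omega> - \<theta>)) = (LINT x|std_normal_distribution. cos (u * (sqrt v * x) - \<theta>))"
    by (rule centered_gaussian_integral[OF assms]) simp
  also have "\<dots> = cos \<theta> * exp (- (u * sqrt v)\<^sup>2 / 2)"
    using std_normal_cos_shift[of "u * sqrt v"] by (simp add: mult.assoc)
  finally show ?thesis using v by (simp add: power_mult_distrib)
qed

text \<open>\<open>gaussian_process\<close> only asserts that parameters of each law exist. The mean
  parameter is recovered here from the expectation; the variance is identified later from the second
  moment.\<close>

lemma centered_gaussian_of_mean_zero:
  assumes [measurable]: "L \<in> borel_measurable M" and "distr M borel L = gaussian_law m v" "0 \<le> v"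
    and "integral\<^sup>L M L = 0"
  shows "centered_gaussian M L v"
proof -
  interpret real_distribution std_normal_distribution by (rule real_dist_normal_dist)
  have d: "distr M borel L = distr std_normal_distribution borel (\<lambda>x. m + sqrt v * x)"
    using assms gaussian_law_eq_distr by simp
  have "integral\<^sup>L M L = (LINT x|std_normal_distribution. m + sqrt v * x)"
    using arg_cong[OF d, of "\<lambda>N. integral\<^sup>L N (\<lambda>x. x)"] by (simp add: integral_distr)
  also have "\<dots> = m"
    using std_normal_mean(1) prob_space by (simp add: std_normal_mean(2))
  finally have "m = 0" using assms by simp
  with assms show ?thesis by (simp add: centered_gaussian_def)
qed

lemma isCont_cdf_std_normal: "isCont (cdf std_normal_distribution) x"
proof -
  interpret real_distribution std_normal_distribution by (rule real_dist_normal_dist)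
  have "emeasure std_normal_distribution {x} = 0"
    by (subst emeasure_density) (auto simp: nn_integral_0_iff_AE intro!: AE_mp[OF AE_lborel_singleton[of x]])
  then show ?thesis by (simp add: isCont_cdf measure_def)
qed

text \<open>Positivity matters for unbounded intervals, where the limit \<open>top * c\<close>
  equals \<open>top\<close> only for \<open>c > 0\<close>.\<close>

lemma cdf_std_normal_pos: "0 < cdf std_normal_distribution x"
proof (rule ccontr)
  interpret real_distribution std_normal_distribution by (rule real_dist_normal_dist)
  assume "\<not> 0 < cdf std_normal_distribution x"
  then have "emeasure std_normal_distribution {..x} = 0"
    by (simp add: cdf_def emeasure_eq_measure zero_less_measure_iff)
  then have "AE y in lborel. ennreal (std_normal_density y) * indicator {..x} y = 0"
    by (subst (asm) emeasure_density) (auto simp: nn_integral_0_iff_AE)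
  then have "AE y in lborel. y \<notin> {..x}"
  proof eventually_elim
    case (elim y)
    have "0 < std_normal_density y" by (rule normal_density_pos) simp
    with elim show ?case by (auto simp: ennreal_eq_0_iff indicator_def split: if_splits)
  qed
  then have "AE y in lborel. y \<notin> {x - 1..x}" by eventually_elim auto
  then have "emeasure lborel {x - 1..x} = 0"
    by (subst (asm) AE_iff_null_sets[symmetric]) auto
  then show False by simp
qed

section \<open>Increments of fractional Brownian motion\<close>

text \<open>The autocovariance at lag \<open>h\<close> of fractional Gaussian noise with Hurst
  parameter \<alpha> / 2, for real lags.\<close>

definition unit_increment_corr :: "real \<Rightarrow> real \<Rightarrow> real" where
  "unit_increment_corr \<alpha> h = (\<bar>h + 1\<bar> powr \<alpha> + \<bar>h - 1\<bar> powr \<alpha> - 2 * \<bar>h\<bar> powr \<alpha>) / 2"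

lemma unit_increment_corr_abs: "unit_increment_corr \<alpha> h = unit_increment_corr \<alpha> \<bar>h\<bar>"
  by (cases "h \<ge> 0") (auto simp: unit_increment_corr_def abs_minus_commute add.commute)

text \<open>In the second-order Taylor expansions at \<open>h + 1\<close> and \<open>h - 1\<close>
  the first-order terms cancel. Intermediate points are at least \<open>h - 1\<close>, hence at
  least \<open>h / 2\<close>, so each remainder is at most
  \<open>2 powr (2 - \<alpha>) * h powr (\<alpha> - 2)\<close> times half of |\<alpha> (\<alpha> -
  1)|, which is at most 1. Each remainder thus contributes a factor 4.\<close>

lemma powr_second_difference_bound:
  fixes h \<alpha> :: real
  assumes "2 \<le> h" "0 < \<alpha>" "\<alpha> < 2"
  shows "\<bar>(h + 1) powr \<alpha> + (h - 1) powr \<alpha> - 2 * h powr \<alpha>\<bar> \<le> 8 * h powr (\<alpha> - 2)"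
proof -
  define d :: "nat \<Rightarrow> real \<Rightarrow> real" where
    "d = (\<lambda>m x. if m = 0 then x powr \<alpha> else if m = 1 then \<alpha> * x powr (\<alpha> - 1)
             else \<alpha> * (\<alpha> - 1) * x powr (\<alpha> - 2))"
  have der: "\<forall>m t. m < 2 \<and> h - 1 \<le> t \<and> t \<le> h + 1 \<longrightarrow> DERIV (d m) t :> d (Suc m) t"
  proof (intro allI impI)
    fix m :: nat and t assume *: "m < 2 \<and> h - 1 \<le> t \<and> t \<le> h + 1"
    then have "t > 0" using assms by simp
    from * have "m = 0 \<or> m = 1" by auto
    then show "DERIV (d m) t :> d (Suc m) t"
    proof
      assume [simp]: "m = 0"
      show ?thesis using has_real_derivative_powr[OF \<open>t > 0\<close>, of \<alpha>] by (simp add: d_def)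
    next
      assume [simp]: "m = 1"
      show ?thesis
        using DERIV_cmult[OF has_real_derivative_powr[OF \<open>t > 0\<close>, of "\<alpha> - 1"], of \<alpha>]
        by (simp add: d_def mult.assoc)
    qed
  qed
  have bound: "\<bar>d 2 t / 2\<bar> \<le> 4 * h powr (\<alpha> - 2)" if "h - 1 \<le> t" for t
  proof -
    have t: "0 < t" "h / 2 \<le> t" using that assms by auto
    have "t powr (\<alpha> - 2) \<le> (h / 2) powr (\<alpha> - 2)"
      using t assms by (intro powr_mono2') auto
    also have "\<dots> = h powr (\<alpha> - 2) * 2 powr (2 - \<alpha>)"
      using assms powr_minus_divide[of 2 "2 - \<alpha>"] by (simp add: powr_divide)
    also have "\<dots> \<le> h powr (\<alpha> - 2) * 2 powr 2"
      using assms by (intro mult_left_mono powr_mono) auto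
    finally have 1: "t powr (\<alpha> - 2) \<le> 4 * h powr (\<alpha> - 2)" by simp
    have "\<bar>\<alpha> * (\<alpha> - 1)\<bar> \<le> 2 * 1" unfolding abs_mult
      using assms by (intro mult_mono) auto
    then have "\<bar>\<alpha> * (\<alpha> - 1)\<bar> * t powr (\<alpha> - 2) \<le> 2 * (4 * h powr (\<alpha> - 2))"
      using 1 by (intro mult_mono) auto
    then show ?thesis by (simp add: d_def abs_mult)
  qed
  have "\<exists>t. (if h + 1 < h then h + 1 < t \<and> t < h else h < t \<and> t < h + 1) \<and>
      d 0 (h + 1) = (\<Sum>m<2. d m h / fact m * (h + 1 - h) ^ m) + d 2 t / fact 2 * (h + 1 - h)\<^sup>2"
    by (rule Taylor[OF _ _ der]) auto
  then obtain t1 where t1: "h < t1" "(h + 1) powr \<alpha> = h powr \<alpha> + d 1 h + d 2 t1 / 2"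
    by (auto simp: numeral_2_eq_2 d_def)
  have "\<exists>t. (if h - 1 < h then h - 1 < t \<and> t < h else h < t \<and> t < h - 1) \<and>
      d 0 (h - 1) = (\<Sum>m<2. d m h / fact m * (h - 1 - h) ^ m) + d 2 t / fact 2 * (h - 1 - h)\<^sup>2"
    by (rule Taylor[OF _ _ der]) auto
  then obtain t2 where t2: "h - 1 < t2" "(h - 1) powr \<alpha> = h powr \<alpha> - d 1 h + d 2 t2 / 2"
    by (auto simp: numeral_2_eq_2 d_def)
  have "(h + 1) powr \<alpha> + (h - 1) powr \<alpha> - 2 * h powr \<alpha> = d 2 t1 / 2 + d 2 t2 / 2"
    using t1 t2 by simp
  then show ?thesis using bound[of t1] bound[of t2] t1 t2 by linarith
qed

lemma unit_increment_corr_decay: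
  assumes "2 \<le> \<bar>h\<bar>" "0 < \<alpha>" "\<alpha> < 2"
  shows "\<bar>unit_increment_corr \<alpha> h\<bar> \<le> 4 * \<bar>h\<bar> powr (\<alpha> - 2)"
  using powr_second_difference_bound[of "\<bar>h\<bar>" \<alpha>] assms
  by (subst unit_increment_corr_abs) (auto simp: unit_increment_corr_def)

text \<open>\<open>gaussian_process\<close> speaks of sums over sets of distinct times. Closing this
  class under sums and multiples once avoids separate treatment of coinciding times such as
  \<open>s + \<epsilon> = t\<close>.\<close>

definition linear_in :: "(real \<Rightarrow> 'a \<Rightarrow> real) \<Rightarrow> ('a \<Rightarrow> real) \<Rightarrow> bool" where
  "linear_in B L \<longleftrightarrow> (\<exists>J c. finite J \<and> J \<subseteq> {0..} \<and> L = (\<lambda>\<omega>. \<Sum>t\<in>J. c t * B t \<omega>))"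

lemma linear_in_base: "0 \<le> t \<Longrightarrow> linear_in B (B t)"
  unfolding linear_in_def by (intro exI[of _ "{t}"] exI[of _ "\<lambda>_. 1"]) auto

lemma linear_in_scale:
  assumes "linear_in B L" shows "linear_in B (\<lambda>\<omega>. a * L \<omega>)"
proof -
  from assms obtain J c where "finite J" "J \<subseteq> {0..}" "L = (\<lambda>\<omega>. \<Sum>t\<in>J. c t * B t \<omega>)"
    unfolding linear_in_def by blast
  then show ?thesis unfolding linear_in_def
    by (intro exI[of _ J] exI[of _ "\<lambda>t. a * c t"]) (auto simp: sum_distrib_left mult.assoc)
qed

lemma linear_in_add:
  assumes "linear_in B L" "linear_in B L'" shows "linear_in B (\<lambda>\<omega>. L \<omega> + L' \<omega>)"
proof -
  from assms obtain J c J' c' where *: "finite J" "J \<subseteq> {0..}" "L = (\<lambda>\<omega>. \<Sum>t\<in>J. c t * B t \<omega>)"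
    "finite J'" "J' \<subseteq> {0..}" "L' = (\<lambda>\<omega>. \<Sum>t\<in>J'. c' t * B t \<omega>)"
    unfolding linear_in_def by blast
  define e where "e t = (if t \<in> J then c t else 0) + (if t \<in> J' then c' t else 0)" for t
  have "L \<omega> + L' \<omega> = (\<Sum>t\<in>J \<union> J'. e t * B t \<omega>)" for \<omega>
  proof -
    have "L \<omega> = (\<Sum>t\<in>J \<union> J'. (if t \<in> J then c t else 0) * B t \<omega>)"
      unfolding * using *(1,4) by (intro sum.mono_neutral_cong_left) auto
    moreover have "L' \<omega> = (\<Sum>t\<in>J \<union> J'. (if t \<in> J' then c' t else 0) * B t \<omega>)"
      unfolding * using *(1,4) by (intro sum.mono_neutral_cong_left) auto
    ultimately show ?thesis by (simp add: e_def sum.distrib distrib_right)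
  qed
  then show ?thesis unfolding linear_in_def using *
    by (intro exI[of _ "J \<union> J'"] exI[of _ e]) auto
qed

lemma linear_in_diff:
  assumes "linear_in B L" "linear_in B L'" shows "linear_in B (\<lambda>\<omega>. L \<omega> - L' \<omega>)"
  using linear_in_add[OF assms(1) linear_in_scale[OF assms(2), of "-1"]] by simp

lemma integrable_mult_of_squares:
  fixes f g :: "'a \<Rightarrow> real"
  assumes [measurable]: "f \<in> borel_measurable M" "g \<in> borel_measurable M"
    and "integrable M (\<lambda>x. (f x)\<^sup>2)" "integrable M (\<lambda>x. (g x)\<^sup>2)"
  shows "integrable M (\<lambda>x. f x * g x)"
proof (rule Bochner_Integration.integrable_bound)
  show "integrable M (\<lambda>x. (f x)\<^sup>2 + (g x)\<^sup>2)" using assms by simp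
  have "\<bar>a * b\<bar> \<le> a\<^sup>2 + b\<^sup>2" for a b :: real
    using sum_squares_bound[of "\<bar>a\<bar>" "\<bar>b\<bar>"] abs_ge_zero[of "a*b"]
    unfolding abs_mult power2_abs by linarith
  then show "AE x in M. norm (f x * g x) \<le> norm ((f x)\<^sup>2 + (g x)\<^sup>2)"
    by auto
qed simp

locale fbm = prob_space M for M :: "'a measure" +
  fixes \<alpha> :: real and B :: "real \<Rightarrow> 'a \<Rightarrow> real"
  assumes \<alpha>: "0 < \<alpha>" "\<alpha> < 2"
    and fbm: "fractional_brownian_motion M (\<alpha> / 2) B"
begin

lemma measurable_B [measurable (raw)]: "0 \<le> t \<Longrightarrow> B t \<in> borel_measurable M"
  using fbm by (auto simp: fractional_brownian_motion_def gaussian_process_def)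

lemma gaussian_B:
  assumes "finite J" "J \<subseteq> {0..}"
  obtains m v where "v \<ge> 0" "distr M borel (\<lambda>\<omega>. \<Sum>t\<in>J. c t * B t \<omega>) = gaussian_law m v"
proof -
  have "\<forall>J c. finite J \<longrightarrow> J \<subseteq> {0..} \<longrightarrow>
      (\<exists>m v. v \<ge> 0 \<and> distr M borel (\<lambda>\<omega>. \<Sum>t\<in>J. c t * B t \<omega>) = gaussian_law m v)"
    using fbm unfolding fractional_brownian_motion_def gaussian_process_def by (elim conjE)
  from this[rule_format, OF assms, of c] that show thesis by (elim exE conjE)
qed

lemma B_mean: "0 \<le> t \<Longrightarrow> integral\<^sup>L M (B t) = 0"
  using fbm by (auto simp: fractional_brownian_motion_def)

lemma B_cov: "0 \<le> s \<Longrightarrow> 0 \<le> t \<Longrightarrow>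
    integral\<^sup>L M (\<lambda>\<omega>. B s \<omega> * B t \<omega>) = (t powr \<alpha> + s powr \<alpha> - \<bar>t - s\<bar> powr \<alpha>) / 2"
  using fbm by (auto simp: fractional_brownian_motion_def)

lemma integrable_B: "0 \<le> t \<Longrightarrow> integrable M (B t)"
proof -
  assume t: "0 \<le> t"
  obtain m v where "v \<ge> 0" "distr M borel (\<lambda>\<omega>. \<Sum>t\<in>{t}. 1 * B t \<omega>) = gaussian_law m v"
    using gaussian_B[of "{t}" "\<lambda>_. 1"] t by (metis atLeast_iff empty_subsetI finite.emptyI finite.insertI insert_subset)
  then have "centered_gaussian M (B t) v"
    using t by (intro centered_gaussian_of_mean_zero[of _ _ m]) (auto simp: B_mean)
  then show ?thesis by (rule centered_gaussian_square)
qed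

text \<open>The second moment alone determines the law, so every later distributional question
  becomes a covariance computation.\<close>

lemma linear_in_gaussian:
  assumes "linear_in B L"
  shows "centered_gaussian M L (integral\<^sup>L M (\<lambda>\<omega>. (L \<omega>)\<^sup>2))"
proof -
  from assms obtain J c where J: "finite J" "J \<subseteq> {0..}" "L = (\<lambda>\<omega>. \<Sum>t\<in>J. c t * B t \<omega>)"
    unfolding linear_in_def by blast
  obtain m v where v: "v \<ge> 0" "distr M borel L = gaussian_law m v"
    using gaussian_B[OF J(1,2), of c] unfolding J(3) by metis
  have t: "t \<in> J \<Longrightarrow> 0 \<le> t" for t using J(2) by auto
  have meas: "L \<in> borel_measurable M"
    unfolding J(3) by (intro borel_measurable_sum borel_measurable_times measurable_B t measurable_const) auto
  have "integral\<^sup>L M L = (\<Sum>t\<in>J. c t * integral\<^sup>L M (B t))"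
    unfolding J(3) by (simp add: integrable_B t)
  also have "\<dots> = 0"
    by (intro sum.neutral ballI) (simp add: B_mean t)
  finally have "centered_gaussian M L v"
    by (rule centered_gaussian_of_mean_zero[OF meas v(2,1)])
  with centered_gaussian_square(1)[OF this] show ?thesis by simp
qed

lemma linear_in_measurable: "linear_in B L \<Longrightarrow> L \<in> borel_measurable M"
  using linear_in_gaussian by (auto simp: centered_gaussian_def)

lemma integrable_linear_mult:
  assumes "linear_in B L" "linear_in B L'"
  shows "integrable M (\<lambda>\<omega>. L \<omega> * L' \<omega>)"
  using assms centered_gaussian_square(3)[OF linear_in_gaussian[OF assms(1)]]
    centered_gaussian_square(3)[OF linear_in_gaussian[OF assms(2)]]
  by (intro integrable_mult_of_squares linear_in_measurable)

lemma integrable_B_mult: "0 \<le> s \<Longrightarrow> 0 \<le> t \<Longrightarrow> integrable M (\<lambda>\<omega>. B s \<omega> * B t \<omega>)"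
  by (intro integrable_linear_mult linear_in_base)

lemma B_increment_square:
  assumes "0 \<le> s" "0 \<le> t"
  shows "integral\<^sup>L M (\<lambda>\<omega>. (B t \<omega> - B s \<omega>)\<^sup>2) = \<bar>t - s\<bar> powr \<alpha>"
proof -
  have "integral\<^sup>L M (\<lambda>\<omega>. (B t \<omega> - B s \<omega>)\<^sup>2)
     = integral\<^sup>L M (\<lambda>\<omega>. B t \<omega> * B t \<omega> - 2 * (B s \<omega> * B t \<omega>) + B s \<omega> * B s \<omega>)"
    by (rule Bochner_Integration.integral_cong) (auto simp: power2_eq_square algebra_simps)
  also have "\<dots> = \<bar>t - s\<bar> powr \<alpha>"
    using assms by (simp add: integrable_B_mult B_cov diff_divide_distrib add_divide_distrib)
  finally show ?thesis .
qed

lemma B_increment_gaussian: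
  assumes "0 \<le> s" "0 \<le> t"
  shows "centered_gaussian M (\<lambda>\<omega>. B t \<omega> - B s \<omega>) (\<bar>t - s\<bar> powr \<alpha>)"
  using linear_in_gaussian[OF linear_in_diff[OF linear_in_base linear_in_base], of t s] assms
  by (simp add: B_increment_square)

section \<open>Normalised increments and covariances of functions of them\<close>

abbreviation Z :: "real \<Rightarrow> real \<Rightarrow> 'a \<Rightarrow> real" where
  "Z \<equiv> normalized_increment \<alpha> B"

lemma linear_in_Z: "0 < \<epsilon> \<Longrightarrow> 0 \<le> t \<Longrightarrow> linear_in B (Z \<epsilon> t)"
  unfolding normalized_increment_def[abs_def]
  by (intro linear_in_scale linear_in_diff linear_in_base) auto

text \<open>Self-similarity: the factor \<epsilon> powr (- \<alpha>) is absorbed into the powers of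
  the time differences, which are thereby measured in units of \<epsilon>.\<close>

lemma Z_cov:
  assumes \<epsilon>: "0 < \<epsilon>" and "0 \<le> s" "0 \<le> t"
  shows "integral\<^sup>L M (\<lambda>\<omega>. Z \<epsilon> s \<omega> * Z \<epsilon> t \<omega>) = unit_increment_corr \<alpha> ((t - s) / \<epsilon>)"
proof -
  define c where "c = \<epsilon> powr (- \<alpha>)"
  have c: "\<epsilon> powr (- \<alpha> / 2) * \<epsilon> powr (- \<alpha> / 2) = c"
    by (simp add: c_def flip: powr_add)
  have "integral\<^sup>L M (\<lambda>\<omega>. Z \<epsilon> s \<omega> * Z \<epsilon> t \<omega>) =
    integral\<^sup>L M (\<lambda>\<omega>. c * (B (s + \<epsilon>) \<omega> * B (t + \<epsilon>) \<omega> - B (s + \<epsilon>) \<omega> * B t \<omega>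
        - B s \<omega> * B (t + \<epsilon>) \<omega> + B s \<omega> * B t \<omega>))"
    unfolding c[symmetric] by (rule Bochner_Integration.integral_cong) (auto simp: normalized_increment_def algebra_simps)
  also have "\<dots> = c * ((\<bar>t - s + \<epsilon>\<bar> powr \<alpha> + \<bar>t - s - \<epsilon>\<bar> powr \<alpha> - 2 * \<bar>t - s\<bar> powr \<alpha>) / 2)"
  proof -
    have "\<bar>t - (s + \<epsilon>)\<bar> = \<bar>t - s - \<epsilon>\<bar>" "\<bar>t + \<epsilon> - s\<bar> = \<bar>t - s + \<epsilon>\<bar>" "\<bar>t + \<epsilon> - (s + \<epsilon>)\<bar> = \<bar>t - s\<bar>"
      by simp_all
    then show ?thesis
      using assms by (simp add: integrable_B_mult B_cov diff_divide_distrib add_divide_distrib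
        del: add_diff_cancel_right diff_diff_add)
  qed
  also have "\<dots> = unit_increment_corr \<alpha> ((t - s) / \<epsilon>)"
  proof -
    have *: "c * \<bar>y\<bar> powr \<alpha> = \<bar>y / \<epsilon>\<bar> powr \<alpha>" for y
      using \<epsilon> by (simp add: c_def powr_divide powr_minus field_simps)
    have "(t - s) / \<epsilon> + 1 = (t - s + \<epsilon>) / \<epsilon>" "(t - s) / \<epsilon> - 1 = (t - s - \<epsilon>) / \<epsilon>"
      using \<epsilon> by (auto simp: field_simps)
    then show ?thesis unfolding unit_increment_corr_def
      by (simp only: *[symmetric]) (simp add: algebra_simps)
  qed
  finally show ?thesis .
qed

lemma Z_var: "0 < \<epsilon> \<Longrightarrow> 0 \<le> t \<Longrightarrow> integral\<^sup>L M (\<lambda>\<omega>. (Z \<epsilon> t \<omega>)\<^sup>2) = 1"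
  using Z_cov[of \<epsilon> t t] by (simp add: power2_eq_square unit_increment_corr_def)

lemma Z_gaussian: "0 < \<epsilon> \<Longrightarrow> 0 \<le> t \<Longrightarrow> centered_gaussian M (Z \<epsilon> t) 1"
  using linear_in_gaussian[OF linear_in_Z] by (simp add: Z_var)

context
  fixes \<epsilon> s t r :: real
  assumes st: "0 < \<epsilon>" "0 \<le> s" "0 \<le> t"
  defines "r \<equiv> unit_increment_corr \<alpha> ((t - s) / \<epsilon>)"
begin

lemma Z_add_gaussian: "centered_gaussian M (\<lambda>\<omega>. Z \<epsilon> s \<omega> + Z \<epsilon> t \<omega>) (2 + 2 * r)"
proof -
  note Z = linear_in_Z[OF st(1,2)] linear_in_Z[OF st(1,3)]
  have "integral\<^sup>L M (\<lambda>\<omega>. (Z \<epsilon> s \<omega> + Z \<epsilon> t \<omega>)\<^sup>2) = integral\<^sup>L M (\<lambda>\<omega>. (Z \<epsilon> s \<omega>)\<^sup>2 + (Z \<epsilon> t \<omega>)\<^sup>2 + 2 * (Z \<epsilon> s \<omega> * Z \<epsilon> t \<omega>))"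
    by (simp add: power2_sum mult.assoc)
  also have "\<dots> = 2 + 2 * r"
    using integrable_linear_mult[OF Z] integrable_linear_mult[OF Z(1) Z(1)] integrable_linear_mult[OF Z(2) Z(2)] st
    by (simp add: Z_var Z_cov r_def flip: power2_eq_square)
  finally show ?thesis
    using linear_in_gaussian[OF linear_in_add[OF Z]] by simp
qed

lemma Z_diff_gaussian: "centered_gaussian M (\<lambda>\<omega>. Z \<epsilon> s \<omega> - Z \<epsilon> t \<omega>) (2 - 2 * r)"
proof -
  note Z = linear_in_Z[OF st(1,2)] linear_in_Z[OF st(1,3)]
  have "integral\<^sup>L M (\<lambda>\<omega>. (Z \<epsilon> s \<omega> - Z \<epsilon> t \<omega>)\<^sup>2) = integral\<^sup>L M (\<lambda>\<omega>. (Z \<epsilon> s \<omega>)\<^sup>2 + (Z \<epsilon> t \<omega>)\<^sup>2 - 2 * (Z \<epsilon> s \<omega> * Z \<epsilon> t \<omega>))"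
    by (simp add: power2_diff mult.assoc)
  also have "\<dots> = 2 - 2 * r"
    using integrable_linear_mult[OF Z] integrable_linear_mult[OF Z(1) Z(1)] integrable_linear_mult[OF Z(2) Z(2)] st
    by (simp add: Z_var Z_cov r_def flip: power2_eq_square)
  finally show ?thesis
    using linear_in_gaussian[OF linear_in_diff[OF Z]] by simp
qed

text \<open>Both \<open>2 + 2 * r\<close> and \<open>2 - 2 * r\<close> are variances.\<close>

lemma corr_le_1: "\<bar>r\<bar> \<le> 1"
  using Z_add_gaussian Z_diff_gaussian by (auto simp: centered_gaussian_def)

lemma measurable_Z_pair: "Z \<epsilon> s \<in> borel_measurable M" "Z \<epsilon> t \<in> borel_measurable M"
  using linear_in_Z linear_in_measurable st by auto

text \<open>By the product-to-sum formula only cosines of the difference and the sum occur, with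
  variances \<open>2 - 2 * r\<close> and \<open>2 + 2 * r\<close>. The constant \<open>c\<close> is
  the exact mean, so the covariance vanishes at \<open>r = 0\<close>; what remains is
  \<open>exp (- u ^ 2)\<close> times multiples of \<open>exp x - 1\<close> with \<open>x\<close>
  equal to plus or minus \<open>u ^ 2 * r\<close>.\<close>

lemma cos_cov:
  fixes u \<theta> :: real
  defines "c \<equiv> cos \<theta> * exp (- u\<^sup>2 / 2)"
  shows "\<bar>integral\<^sup>L M (\<lambda>\<omega>. (cos (u * Z \<epsilon> s \<omega> - \<theta>) - c) * (cos (u * Z \<epsilon> t \<omega> - \<theta>) - c))\<bar> \<le> u\<^sup>2 * \<bar>r\<bar>"
proof -
  note [measurable] = measurable_Z_pair
  have int: "integrable M (\<lambda>\<omega>. cos (X \<omega>))" if [measurable]: "X \<in> borel_measurable M" for X :: "'a \<Rightarrow> real"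
    by (rule integrable_const_bound[where B=1]) auto
  have "integral\<^sup>L M (\<lambda>\<omega>. (cos (u * Z \<epsilon> s \<omega> - \<theta>) - c) * (cos (u * Z \<epsilon> t \<omega> - \<theta>) - c))
    = integral\<^sup>L M (\<lambda>\<omega>. (cos (u * (Z \<epsilon> s \<omega> - Z \<epsilon> t \<omega>) - 0) + cos (u * (Z \<epsilon> s \<omega> + Z \<epsilon> t \<omega>) - 2 * \<theta>)) / 2
        - c * cos (u * Z \<epsilon> s \<omega> - \<theta>) - c * cos (u * Z \<epsilon> t \<omega> - \<theta>) + c\<^sup>2)"
    by (rule Bochner_Integration.integral_cong[OF refl])
      (simp add: cos_times_cos power2_eq_square algebra_simps)
  also have "\<dots> = (exp (- u\<^sup>2 * (2 - 2 * r) / 2) + cos (2 * \<theta>) * exp (- u\<^sup>2 * (2 + 2 * r) / 2)) / 2 - c\<^sup>2"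
    using centered_gaussian_cos[OF Z_diff_gaussian, of u 0] centered_gaussian_cos[OF Z_add_gaussian, of u "2*\<theta>"]
      centered_gaussian_cos[OF Z_gaussian[OF st(1,2)], of u \<theta>] centered_gaussian_cos[OF Z_gaussian[OF st(1,3)], of u \<theta>] prob_space
    by (simp add: int c_def power2_eq_square)
  also have "\<dots> = exp (- u\<^sup>2) * ((exp (u\<^sup>2 * r) - 1) + cos (2 * \<theta>) * (exp (- (u\<^sup>2 * r)) - 1)) / 2"
  proof -
    have "exp (- u\<^sup>2 * (2 - 2 * r) / 2) = exp (- u\<^sup>2) * exp (u\<^sup>2 * r)"
      "exp (- u\<^sup>2 * (2 + 2 * r) / 2) = exp (- u\<^sup>2) * exp (- (u\<^sup>2 * r))"
      by (simp_all add: algebra_simps diff_divide_distrib add_divide_distrib flip: exp_add)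
    moreover have "c\<^sup>2 = (1 + cos (2 * \<theta>)) / 2 * exp (- u\<^sup>2)"
    proof -
      have "(exp (- u\<^sup>2 / 2))\<^sup>2 = exp (- u\<^sup>2)" by (simp add: power2_eq_square flip: exp_add)
      then show ?thesis by (simp add: c_def power_mult_distrib cos_double_cos)
    qed
    ultimately show ?thesis by (simp add: algebra_simps)
  qed
  also have "\<bar>\<dots>\<bar> \<le> u\<^sup>2 * \<bar>r\<bar>"
  proof -
    \<comment> \<open>This form keeps the factor linear in \<open>r\<close>. As |r| is at most 1,
      the remaining exponential is at most \<open>exp (u ^ 2)\<close> and cancels against the
      prefactor.\<close>
    have e: "\<bar>exp x - 1\<bar> \<le> \<bar>x\<bar> * exp \<bar>x\<bar>" for x :: real
    proof (cases "x \<ge> 0")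
      case True
      have "1 - x \<le> exp (-x)" using exp_ge_add_one_self[of "-x"] by simp
      then have "(1 - x) * exp x \<le> exp (-x) * exp x" by (intro mult_right_mono) auto
      then show ?thesis using True by (simp add: algebra_simps flip: exp_add)
    next
      case False
      then have "exp x \<le> 1" by simp
      with False have "\<bar>exp x - 1\<bar> \<le> \<bar>x\<bar> * 1" using exp_ge_add_one_self[of x] by linarith
      also have "\<dots> \<le> \<bar>x\<bar> * exp \<bar>x\<bar>" by (intro mult_left_mono) auto
      finally show ?thesis .
    qed
    have le: "\<bar>u\<^sup>2 * r\<bar> \<le> u\<^sup>2 * 1" unfolding abs_mult
      using corr_le_1 by (intro mult_mono) auto
    have *: "\<bar>exp x - 1\<bar> \<le> u\<^sup>2 * \<bar>r\<bar> * exp (u\<^sup>2)" if "\<bar>x\<bar> = \<bar>u\<^sup>2 * r\<bar>" for x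
    proof -
      have "\<bar>x\<bar> * exp \<bar>x\<bar> \<le> u\<^sup>2 * \<bar>r\<bar> * exp (u\<^sup>2)"
        unfolding that using le by (intro mult_mono) (auto simp: abs_mult)
      with e[of x] show ?thesis by simp
    qed
    let ?K = "u\<^sup>2 * \<bar>r\<bar> * exp (u\<^sup>2)"
    have "\<bar>cos (2 * \<theta>) * (exp (- (u\<^sup>2 * r)) - 1)\<bar> \<le> 1 * ?K"
      unfolding abs_mult using *[of "- (u\<^sup>2 * r)"] by (intro mult_mono) (auto simp: abs_mult)
    with *[of "u\<^sup>2 * r"] have "\<bar>(exp (u\<^sup>2 * r) - 1) + cos (2 * \<theta>) * (exp (- (u\<^sup>2 * r)) - 1)\<bar> \<le> 2 * ?K"
      by linarith
    then have "exp (- u\<^sup>2) * \<bar>(exp (u\<^sup>2 * r) - 1) + cos (2 * \<theta>) * (exp (- (u\<^sup>2 * r)) - 1)\<bar> \<le> exp (- u\<^sup>2) * (2 * ?K)"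
      by (intro mult_left_mono) auto
    also have "\<dots> = 2 * (u\<^sup>2 * \<bar>r\<bar>)" by (simp add: exp_minus)
    finally show ?thesis by (simp add: abs_mult)
  qed
  finally show ?thesis .
qed

text \<open>Polarisation: \<open>12 x\<^sup>2 y\<^sup>2 = (x + y)\<^sup>4 + (x - y)\<^sup>4 - 2 x\<^sup>4 - 2 y\<^sup>4\<close> reduces the mixed moment to laws of
  single linear combinations.\<close>

lemma square_cov:
  "\<bar>integral\<^sup>L M (\<lambda>\<omega>. ((Z \<epsilon> s \<omega>)\<^sup>2 - 1) * ((Z \<epsilon> t \<omega>)\<^sup>2 - 1))\<bar> \<le> 2 * \<bar>r\<bar>"
proof -
  have m: "integrable M (\<lambda>\<omega>. L \<omega> ^ j)" if "centered_gaussian M L v" for L v j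
    using centered_gaussian_moments(2)[OF that] .
  note g = Z_gaussian[OF st(1,2)] Z_gaussian[OF st(1,3)] Z_add_gaussian Z_diff_gaussian
  have "integral\<^sup>L M (\<lambda>\<omega>. ((Z \<epsilon> s \<omega>)\<^sup>2 - 1) * ((Z \<epsilon> t \<omega>)\<^sup>2 - 1))
    = integral\<^sup>L M (\<lambda>\<omega>. ((Z \<epsilon> s \<omega> + Z \<epsilon> t \<omega>) ^ 4 + (Z \<epsilon> s \<omega> - Z \<epsilon> t \<omega>) ^ 4
         - 2 * Z \<epsilon> s \<omega> ^ 4 - 2 * Z \<epsilon> t \<omega> ^ 4) / 12 - (Z \<epsilon> s \<omega>)\<^sup>2 - (Z \<epsilon> t \<omega>)\<^sup>2 + 1)"
    by (rule Bochner_Integration.integral_cong[OF refl]) (simp add: power4_eq_xxxx power2_eq_square algebra_simps)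
  also have "\<dots> = (3 * (2 + 2 * r)\<^sup>2 + 3 * (2 - 2 * r)\<^sup>2 - 12) / 12 - 1"
    using m[OF g(1)] m[OF g(2)] m[OF g(3)] m[OF g(4)] prob_space
      centered_gaussian_square(1,2)[OF g(1)] centered_gaussian_square(1,2)[OF g(2)]
      centered_gaussian_square(2)[OF g(3)] centered_gaussian_square(2)[OF g(4)]
    by simp
  also have "\<dots> = 2 * \<bar>r\<bar> * \<bar>r\<bar>" by (simp add: power2_eq_square algebra_simps)
  also have "\<bar>\<dots>\<bar> \<le> 2 * \<bar>r\<bar> * 1" unfolding abs_mult using corr_le_1 by (intro mult_mono) auto
  finally show ?thesis by simp
qed

end

end

section \<open>Second moments of time averages\<close>

text \<open>Takes the place of Markov's inequality plus Borel-Cantelli: the sum of all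
  \<open>f n\<close> has finite expectation, hence is finite almost everywhere, and the terms of a
  convergent series tend to 0.\<close>

lemma AE_LIMSEQ_zero_of_summable_integral:
  fixes f :: "nat \<Rightarrow> 'a \<Rightarrow> real"
  assumes int: "\<And>n. integrable M (f n)" and nonneg: "\<And>n \<omega>. 0 \<le> f n \<omega>"
    and "summable (\<lambda>n. integral\<^sup>L M (f n))"
  shows "AE \<omega> in M. (\<lambda>n. f n \<omega>) \<longlonglongrightarrow> 0"
proof -
  have [measurable]: "f n \<in> borel_measurable M" for n using int by auto
  have "(\<integral>\<^sup>+\<omega>. (\<Sum>n. ennreal (f n \<omega>)) \<partial>M) = (\<Sum>n. \<integral>\<^sup>+\<omega>. ennreal (f n \<omega>) \<partial>M)"
    by (rule nn_integral_suminf) simp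
  also have "\<dots> = (\<Sum>n. ennreal (integral\<^sup>L M (f n)))"
    using int nonneg by (simp add: nn_integral_eq_integral)
  also have "\<dots> \<noteq> \<infinity>"
    using assms by (simp add: suminf_ennreal2)
  finally have "AE \<omega> in M. (\<Sum>n. ennreal (f n \<omega>)) \<noteq> \<infinity>"
    by (intro nn_integral_PInf_AE) simp_all
  then show ?thesis
    by eventually_elim (use nonneg in \<open>auto intro!: summable_LIMSEQ_zero summable_suminf_not_top\<close>)
qed

text \<open>Fubini needs joint measurability. Rounding the time down to a multiple of
  \<open>1 / Suc n\<close> leaves countably many times, each with a measurable section, and
  continuity recovers the process in the limit.\<close>

lemma continuous_process_measurable:
  fixes f :: "real \<Rightarrow> 'a \<Rightarrow> real"
  assumes [measurable]: "\<And>t. f t \<in> borel_measurable M"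
    and cont: "\<And>\<omega>. \<omega> \<in> space M \<Longrightarrow> continuous_on UNIV (\<lambda>t. f t \<omega>)"
  shows "(\<lambda>(t, \<omega>). f t \<omega>) \<in> borel_measurable (borel \<Otimes>\<^sub>M M)"
proof (rule borel_measurable_LIMSEQ_real)
  define d where "d n t = real_of_int \<lfloor>real (Suc n) * t\<rfloor> / real (Suc n)" for n t
  show "(\<lambda>x. f (d n (fst x)) (snd x)) \<in> borel_measurable (borel \<Otimes>\<^sub>M M)" for n
  proof -
    have "(\<lambda>x. f (real_of_int i / real (Suc n)) (snd x)) \<in> borel_measurable (borel \<Otimes>\<^sub>M M)" for i :: int
      by measurable
    moreover have "(\<lambda>x. \<lfloor>real (Suc n) * fst x\<rfloor>) \<in> borel \<Otimes>\<^sub>M M \<rightarrow>\<^sub>M count_space UNIV"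
      by measurable
    ultimately show ?thesis
      unfolding d_def
      by (rule measurable_compose_countable[where f = "\<lambda>i x. f (real_of_int i / real (Suc n)) (snd x)"])
  qed
  fix x :: "real \<times> 'a" assume "x \<in> space (borel \<Otimes>\<^sub>M M)"
  then have "snd x \<in> space M" by (auto simp: space_pair_measure)
  from cont[OF this] have "isCont (\<lambda>t. f t (snd x)) (fst x)"
    by (simp add: continuous_on_eq_continuous_at)
  moreover have "(\<lambda>n. d n t) \<longlonglongrightarrow> t" for t
  proof (rule tendsto_sandwich)
    show "(\<lambda>n. t - 1 / real (Suc n)) \<longlonglongrightarrow> t"
      using tendsto_diff[OF tendsto_const LIMSEQ_inverse_real_of_nat, of t] by (simp add: inverse_eq_divide)
    show "\<forall>\<^sub>F n in sequentially. t - 1 / real (Suc n) \<le> d n t"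
    proof (intro always_eventually allI)
      fix n
      have "real (Suc n) * t - 1 \<le> real_of_int \<lfloor>real (Suc n) * t\<rfloor>" by linarith
      then have "(real (Suc n) * t - 1) / real (Suc n) \<le> d n t"
        unfolding d_def by (intro divide_right_mono) auto
      then show "t - 1 / real (Suc n) \<le> d n t" by (simp add: diff_divide_distrib)
    qed
    show "\<forall>\<^sub>F n in sequentially. d n t \<le> t"
    proof (intro always_eventually allI)
      fix n
      have "d n t \<le> real (Suc n) * t / real (Suc n)"
        unfolding d_def by (intro divide_right_mono) auto
      then show "d n t \<le> t" by simp
    qed
  qed simp
  ultimately show "(\<lambda>n. f (d n (fst x)) (snd x)) \<longlonglongrightarrow> (case x of (t, \<omega>) \<Rightarrow> f t \<omega>)"
    by (auto simp: case_prod_beta intro: isCont_tendsto_compose)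
qed

text \<open>The squared average is a double average over pairs of times, and Fubini moves the
  expectation inside, where the covariance bound \<open>r\<close> applies. The bound
  \<open>K\<close> supplies the absolute integrability for Fubini.\<close>

lemma second_moment_of_average:
  fixes X :: "'b \<Rightarrow> 'a \<Rightarrow> real" and r :: "'b \<Rightarrow> 'b \<Rightarrow> real"
  assumes "prob_space M" "prob_space N"
    and X[measurable]: "(\<lambda>(t, \<omega>). X t \<omega>) \<in> borel_measurable (N \<Otimes>\<^sub>M M)"
    and sq: "\<And>t. t \<in> space N \<Longrightarrow> integrable M (\<lambda>\<omega>. (X t \<omega>)\<^sup>2)"
    and K: "\<And>t. t \<in> space N \<Longrightarrow> integral\<^sup>L M (\<lambda>\<omega>. (X t \<omega>)\<^sup>2) \<le> K"
    and cov: "\<And>s t. s \<in> space N \<Longrightarrow> t \<in> space N \<Longrightarrow> integral\<^sup>L M (\<lambda>\<omega>. X s \<omega> * X t \<omega>) \<le> r s t"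
    and r: "integrable (N \<Otimes>\<^sub>M N) (\<lambda>(s, t). r s t)"
  shows "integrable M (\<lambda>\<omega>. (LINT t|N. X t \<omega>)\<^sup>2)"
    and "integral\<^sup>L M (\<lambda>\<omega>. (LINT t|N. X t \<omega>)\<^sup>2) \<le> (LINT s|N. LINT t|N. r s t)"
proof -
  interpret M: prob_space M by fact
  interpret N: prob_space N by fact
  interpret NN: pair_prob_space N N ..
  interpret NNM: pair_sigma_finite "N \<Otimes>\<^sub>M N" M ..
  let ?F = "\<lambda>p \<omega>. X (fst p) \<omega> * X (snd p) \<omega>"
  have [measurable]: "(\<lambda>x. X (f x) (g x)) \<in> borel_measurable L"
    if "f \<in> L \<rightarrow>\<^sub>M N" "g \<in> L \<rightarrow>\<^sub>M M" for L :: "(('b \<times> 'b) \<times> 'a) measure" and f g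
    using measurable_compose[OF measurable_Pair[OF that] X] by simp
  have Xm: "X t \<in> borel_measurable M" if "t \<in> space N" for t
    using measurable_Pair2[OF X that] by simp
  have mul: "integrable M (\<lambda>\<omega>. X s \<omega> * X t \<omega>)" if "s \<in> space N" "t \<in> space N" for s t
    using that by (intro integrable_mult_of_squares sq Xm)
  have int: "integrable ((N \<Otimes>\<^sub>M N) \<Otimes>\<^sub>M M) (\<lambda>(p, \<omega>). ?F p \<omega>)"
  proof (rule NNM.Fubini_integrable)
    show "(\<lambda>(p, \<omega>). ?F p \<omega>) \<in> borel_measurable ((N \<Otimes>\<^sub>M N) \<Otimes>\<^sub>M M)"
      by measurable
    show "AE p in N \<Otimes>\<^sub>M N. integrable M (\<lambda>\<omega>. case (p, \<omega>) of (p, \<omega>) \<Rightarrow> ?F p \<omega>)"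
      by (rule AE_I2) (auto simp: space_pair_measure intro: mul)
    show "integrable (N \<Otimes>\<^sub>M N) (\<lambda>p. LINT \<omega>|M. norm (case (p, \<omega>) of (p, \<omega>) \<Rightarrow> ?F p \<omega>))"
    proof (rule NN.integrable_const_bound[where B = "2 * K"])
      show "AE p in N \<Otimes>\<^sub>M N. norm (LINT \<omega>|M. norm (case (p, \<omega>) of (p, \<omega>) \<Rightarrow> ?F p \<omega>)) \<le> 2 * K"
      proof (rule AE_I2)
        fix p assume "p \<in> space (N \<Otimes>\<^sub>M N)"
        then obtain s t where p: "p = (s, t)" "s \<in> space N" "t \<in> space N"
          by (auto simp: space_pair_measure)
        have "\<bar>a * b\<bar> \<le> a\<^sup>2 + b\<^sup>2" for a b :: real
          using sum_squares_bound[of "\<bar>a\<bar>" "\<bar>b\<bar>"] abs_ge_zero[of "a*b"]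
          unfolding abs_mult power2_abs by linarith
        then have "(LINT \<omega>|M. \<bar>X s \<omega> * X t \<omega>\<bar>) \<le> (LINT \<omega>|M. (X s \<omega>)\<^sup>2 + (X t \<omega>)\<^sup>2)"
          using mul[OF p(2,3)] sq p by (intro integral_mono) auto
        also have "\<dots> \<le> 2 * K" using K[OF p(2)] K[OF p(3)] sq p by simp
        finally show "norm (LINT \<omega>|M. norm (case (p, \<omega>) of (p, \<omega>) \<Rightarrow> ?F p \<omega>)) \<le> 2 * K"
          by (simp add: p)
      qed
    qed measurable
  qed
  \<comment> \<open>Only almost everywhere: splitting the double integral requires the product to be
    integrable in the pair of times, which Fubini grants off a null set.\<close>
  have eq: "AE \<omega> in M. (\<integral>p. ?F p \<omega> \<partial>(N \<Otimes>\<^sub>M N)) = (LINT t|N. X t \<omega>)\<^sup>2"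
    using NNM.AE_integrable_snd[OF int]
  proof eventually_elim
    case (elim \<omega>)
    from NN.integral_fst'[OF elim] show ?case
      by (simp add: power2_eq_square)
  qed
  have avg: "(\<lambda>\<omega>. LINT t|N. X t \<omega>) \<in> borel_measurable M"
    by (rule N.borel_measurable_lebesgue_integral) measurable
  have i1: "integrable M (\<lambda>\<omega>. \<integral>p. ?F p \<omega> \<partial>(N \<Otimes>\<^sub>M N))"
    using NNM.integrable_snd[OF int] .
  show "integrable M (\<lambda>\<omega>. (LINT t|N. X t \<omega>)\<^sup>2)"
    by (rule integrable_cong_AE_imp[OF i1 _ eq]) (intro borel_measurable_power avg)
  have "integral\<^sup>L M (\<lambda>\<omega>. (LINT t|N. X t \<omega>)\<^sup>2) = integral\<^sup>L M (\<lambda>\<omega>. \<integral>p. ?F p \<omega> \<partial>(N \<Otimes>\<^sub>M N))"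
    by (intro integral_cong_AE borel_measurable_power avg borel_measurable_integrable[OF i1])
      (use eq in eventually_elim, simp)
  also have "\<dots> = (\<integral>p. (LINT \<omega>|M. ?F p \<omega>) \<partial>(N \<Otimes>\<^sub>M N))"
    by (rule NNM.Fubini_integral[OF int])
  also have "\<dots> \<le> (\<integral>p. (case p of (s, t) \<Rightarrow> r s t) \<partial>(N \<Otimes>\<^sub>M N))"
    using NNM.integrable_fst[OF int] r cov by (intro integral_mono) (auto simp: space_pair_measure)
  also have "\<dots> = (LINT s|N. LINT t|N. r s t)"
    using NN.integral_fst'[OF r] by simp
  finally show "integral\<^sup>L M (\<lambda>\<omega>. (LINT t|N. X t \<omega>)\<^sup>2) \<le> (LINT s|N. LINT t|N. r s t)" .
qed

context fbm
begin

lemma continuous_B: "\<omega> \<in> space M \<Longrightarrow> continuous_on {0..} (\<lambda>t. B t \<omega>)"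
  using fbm by (auto simp: fractional_brownian_motion_def)

text \<open>Only times \<open>t \<ge> 0\<close> are constrained; \<open>max 0 t\<close> extends the increments continuously to the whole line.\<close>

lemma continuous_Z:
  assumes "\<omega> \<in> space M" "0 < \<epsilon>"
  shows "continuous_on UNIV (\<lambda>t. Z \<epsilon> (max 0 t) \<omega>)"
  unfolding normalized_increment_def
  using assms(2)
  by (intro continuous_intros continuous_on_compose2[OF continuous_B[OF assms(1)]]) auto

lemma measurable_Z: "0 < \<epsilon> \<Longrightarrow> 0 \<le> t \<Longrightarrow> Z \<epsilon> t \<in> borel_measurable M"
  by (intro linear_in_measurable linear_in_Z)

lemma measurable_Z_process:
  assumes "0 < \<epsilon>"
  shows "(\<lambda>(t, \<omega>). Z \<epsilon> (max 0 t) \<omega>) \<in> borel_measurable (borel \<Otimes>\<^sub>M M)"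
  using assms by (intro continuous_process_measurable continuous_Z measurable_Z) auto

end

text \<open>Time averages become expectations: a fixed path is a random variable in
  \<open>t\<close>, and its occupation law is a distribution on the line.\<close>

abbreviation uniform_on :: "real \<Rightarrow> real measure" where
  "uniform_on T \<equiv> uniform_measure lborel {0..T}"

lemma prob_space_uniform_on: "0 < T \<Longrightarrow> prob_space (uniform_on T)"
  by (rule prob_space_uniform_measure) auto

lemma AE_uniform_on: "AE t in uniform_on T. t \<in> {0..T}"
  by (rule AE_uniform_measureI) auto

lemma integrable_uniform_on:
  fixes f :: "real \<Rightarrow> real"
  assumes "0 < T" "continuous_on UNIV f"
  shows "integrable (uniform_on T) f"
proof -
  interpret prob_space "uniform_on T" using assms(1) by (rule prob_space_uniform_on)
  have "compact (f ` {0..T})"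
    using assms by (intro compact_continuous_image continuous_on_subset[OF assms(2)]) auto
  then obtain b where "\<forall>x\<in>f ` {0..T}. norm x \<le> b"
    using compact_imp_bounded bounded_iff by metis
  then have b: "norm (f t) \<le> b" if "t \<in> {0..T}" for t using that by blast
  have "f \<in> borel_measurable borel" using assms by (simp add: borel_measurable_continuous_onI)
  then show ?thesis
    by (intro integrable_const_bound[where B = b])
      (use AE_uniform_on[of T] b in \<open>auto elim: eventually_mono simp: uniform_measure_def\<close>)
qed

context fbm
begin

text \<open>Pairs of times closer than \<open>sqrt \<epsilon>\<close> get the trivial bound 1 on the
  correlation; for each \<open>s\<close> they have probability at most
  \<open>2 / T * sqrt \<epsilon>\<close>. For all other pairs the lag is at least
  \<open>1 / sqrt \<epsilon>\<close>, and the decay estimate gives the second term. The decay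
  estimate requires a lag of at least 2, whence the condition
  \<open>\<epsilon> \<le> 1 / 4\<close>.\<close>

lemma average_variance_bound:
  fixes h :: "real \<Rightarrow> real"
  assumes [measurable]: "h \<in> borel_measurable borel" and K: "0 \<le> K"
    and sq: "\<And>\<epsilon> t. 0 < \<epsilon> \<Longrightarrow> 0 \<le> t \<Longrightarrow> integrable M (\<lambda>\<omega>. (h (Z \<epsilon> t \<omega>))\<^sup>2)"
    and cov: "\<And>\<epsilon> s t. 0 < \<epsilon> \<Longrightarrow> 0 \<le> s \<Longrightarrow> 0 \<le> t \<Longrightarrow>
      \<bar>integral\<^sup>L M (\<lambda>\<omega>. h (Z \<epsilon> s \<omega>) * h (Z \<epsilon> t \<omega>))\<bar> \<le> K * \<bar>unit_increment_corr \<alpha> ((t - s) / \<epsilon>)\<bar>"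
    and \<epsilon>: "0 < \<epsilon>" "\<epsilon> \<le> 1 / 4" and T: "0 < T"
  defines "A \<equiv> \<lambda>\<omega>. LINT t|uniform_on T. h (Z \<epsilon> (max 0 t) \<omega>)"
  shows "integrable M (\<lambda>\<omega>. (A \<omega>)\<^sup>2)"
    and "integral\<^sup>L M (\<lambda>\<omega>. (A \<omega>)\<^sup>2) \<le> K * (2 / T * sqrt \<epsilon> + 4 * \<epsilon> powr ((2 - \<alpha>) / 2))"
proof -
  define N where "N = uniform_on T"
  interpret N: prob_space N unfolding N_def using T by (rule prob_space_uniform_on)
  interpret NN: pair_prob_space N N ..
  have sets_N [measurable_cong]: "sets N = sets borel" by (simp add: N_def)
  have [simp]: "space N = UNIV" by (simp add: N_def)
  define \<eta> where "\<eta> = sqrt \<epsilon>"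
  define d where "d = 4 * \<epsilon> powr ((2 - \<alpha>) / 2)"
  define S where "S = {(s, t). \<bar>max 0 s - max 0 t\<bar> < \<eta>}"
  have [measurable]: "S \<in> sets (borel \<Otimes>\<^sub>M borel)"
  proof -
    have "S = {x \<in> space (borel \<Otimes>\<^sub>M borel). \<bar>max 0 (fst x) - max 0 (snd x)\<bar> < \<eta>}"
      by (auto simp: S_def space_pair_measure)
    then show ?thesis by simp
  qed
  have [measurable]: "S \<in> sets (N \<Otimes>\<^sub>M N)"
    using sets_pair_measure_cong[of N borel N borel] by (simp add: N_def)
  have "0 \<le> d" by (simp add: d_def)
  let ?r = "\<lambda>s t. K * (indicat_real S (s, t) + d)"
  have r_int: "integrable (N \<Otimes>\<^sub>M N) (\<lambda>(s, t). ?r s t)"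
    by (rule NN.integrable_const_bound[where B = "K * (1 + d)"])
      (use K \<open>0 \<le> d\<close> in \<open>auto simp: indicator_def abs_mult intro!: mult_left_mono\<close>)
  have corr: "\<bar>unit_increment_corr \<alpha> ((t' - s') / \<epsilon>)\<bar> \<le> indicat_real S (s, t) + d"
    if st: "s' = max 0 s" "t' = max 0 t" for s t s' t'
  proof (cases "(s, t) \<in> S")
    case True
    then show ?thesis using corr_le_1[OF \<epsilon>(1), of s' t'] \<open>0 \<le> d\<close> st by simp
  next
    case False
    have e: "\<eta> / \<epsilon> = 1 / sqrt \<epsilon>"
      using \<epsilon> by (simp add: \<eta>_def field_simps flip: power2_eq_square)
    have *: "\<eta> / \<epsilon> \<le> \<bar>(t' - s') / \<epsilon>\<bar>"
      unfolding abs_divide using False \<epsilon> st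
      by (auto simp: S_def abs_minus_commute intro!: divide_right_mono)
    have "sqrt \<epsilon> \<le> sqrt ((1/2)\<^sup>2)" using \<epsilon> by (intro real_sqrt_le_mono) (simp add: power2_eq_square)
    then have "sqrt \<epsilon> \<le> 1 / 2" by simp
    then have "2 \<le> 1 / sqrt \<epsilon>" using \<epsilon> by (simp add: field_simps)
    with * e have 2: "2 \<le> \<bar>(t' - s') / \<epsilon>\<bar>" by linarith
    have "\<bar>unit_increment_corr \<alpha> ((t' - s') / \<epsilon>)\<bar> \<le> 4 * \<bar>(t' - s') / \<epsilon>\<bar> powr (\<alpha> - 2)"
      using 2 \<alpha> by (rule unit_increment_corr_decay)
    also have "\<dots> \<le> 4 * (1 / sqrt \<epsilon>) powr (\<alpha> - 2)"
      using * e \<epsilon> \<alpha> by (intro mult_left_mono powr_mono2') auto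
    also have "(1 / sqrt \<epsilon>) powr (\<alpha> - 2) = \<epsilon> powr ((2 - \<alpha>) / 2)"
    proof -
      have "1 / sqrt \<epsilon> = \<epsilon> powr (- (1 / 2))"
        using \<epsilon> by (simp add: powr_minus powr_half_sqrt inverse_eq_divide)
      then show ?thesis by (simp add: powr_powr diff_divide_distrib)
    qed
    finally show ?thesis using False by (simp add: d_def)
  qed
  have cov': "integral\<^sup>L M (\<lambda>\<omega>. h (Z \<epsilon> (max 0 s) \<omega>) * h (Z \<epsilon> (max 0 t) \<omega>)) \<le> ?r s t" for s t
  proof -
    have "integral\<^sup>L M (\<lambda>\<omega>. h (Z \<epsilon> (max 0 s) \<omega>) * h (Z \<epsilon> (max 0 t) \<omega>))
        \<le> K * \<bar>unit_increment_corr \<alpha> ((max 0 t - max 0 s) / \<epsilon>)\<bar>"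
      using cov[OF \<epsilon>(1), of "max 0 s" "max 0 t"] by (simp add: abs_le_iff)
    also have "\<dots> \<le> ?r s t" using K corr by (intro mult_left_mono) auto
    finally show ?thesis .
  qed
  \<comment> \<open>The diagonal case of \<open>cov\<close>: at lag 0 the correlation is 1.\<close>
  have var: "integral\<^sup>L M (\<lambda>\<omega>. (h (Z \<epsilon> (max 0 t) \<omega>))\<^sup>2) \<le> K" for t
    using cov[OF \<epsilon>(1), of "max 0 t" "max 0 t"]
    by (simp add: power2_eq_square unit_increment_corr_def abs_le_iff)
  have "(\<lambda>(t, \<omega>). h (Z \<epsilon> (max 0 t) \<omega>)) \<in> borel_measurable (borel \<Otimes>\<^sub>M M)"
    using measurable_compose[OF measurable_Z_process[OF \<epsilon>(1)] assms(1)]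
    by (simp add: case_prod_beta)
  then have meas: "(\<lambda>(t, \<omega>). h (Z \<epsilon> (max 0 t) \<omega>)) \<in> borel_measurable (N \<Otimes>\<^sub>M M)"
    by (subst measurable_cong_sets[OF sets_pair_measure_cong refl, of _ borel _ M]) (auto simp: N_def)
  note main = second_moment_of_average[OF prob_space_axioms N.prob_space_axioms meas
      sq[OF \<epsilon>(1)] var cov' r_int]
  show "integrable M (\<lambda>\<omega>. (A \<omega>)\<^sup>2)"
    using main(1) by (simp add: A_def N_def)
  have "integral\<^sup>L M (\<lambda>\<omega>. (A \<omega>)\<^sup>2) \<le> (LINT s|N. LINT t|N. ?r s t)"
    using main(2) by (simp add: A_def N_def)
  also have "\<dots> \<le> (LINT s|N. K * (2 / T * \<eta> + d))"
  proof (rule integral_mono)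
    show "integrable N (\<lambda>s. LINT t|N. ?r s t)"
      using NN.integrable_fst'[OF r_int] by simp
    fix s
    have S': "Pair s -` S \<in> sets borel" by (simp add: measurable_sets_borel flip: vimage_def)
    have "(LINT t|N. ?r s t) = K * (measure N (Pair s -` S) + d)"
    proof -
      have "(\<lambda>t. ?r s t) = (\<lambda>t. K * (indicat_real (Pair s -` S) t + d))"
        by (auto simp: indicator_def)
      moreover have "integrable N (indicat_real (Pair s -` S))"
        using S' by (intro integrable_real_indicator) (auto simp: sets_N N.emeasure_finite less_top[symmetric])
      ultimately show ?thesis by (simp add: N.prob_space[simplified])
    qed
    also have "measure N (Pair s -` S) \<le> 2 / T * \<eta>"
    proof -
      have "measure lborel ({0..T} \<inter> Pair s -` S) \<le> measure lborel {max 0 s - \<eta>..max 0 s + \<eta>}"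
        using S' \<epsilon> by (intro measure_mono_fmeasurable) (auto simp: S_def fmeasurable_def \<eta>_def)
      also have "\<dots> = 2 * \<eta>" using \<epsilon> by (simp add: \<eta>_def)
      finally show ?thesis using T S' unfolding N_def
        by (subst measure_uniform_measure) (auto simp: field_simps)
    qed
    finally show "(LINT t|N. ?r s t) \<le> K * (2 / T * \<eta> + d)"
      using K by (simp add: mult_left_mono)
  qed simp
  also have "\<dots> = K * (2 / T * sqrt \<epsilon> + 4 * \<epsilon> powr ((2 - \<alpha>) / 2))"
    using N.prob_space by (simp add: \<eta>_def d_def)
  finally show "integral\<^sup>L M (\<lambda>\<omega>. (A \<omega>)\<^sup>2) \<le> K * (2 / T * sqrt \<epsilon> + 4 * \<epsilon> powr ((2 - \<alpha>) / 2))" .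
qed

end

section \<open>Convergence along a polynomial grid\<close>

text \<open>The shift by 2 keeps every grid point below \<open>1 / 4\<close> for the exponents in
  use, as the variance bound requires.\<close>

definition power_grid :: "real \<Rightarrow> nat \<Rightarrow> real" where
  "power_grid a n = real (n + 2) powr - a"

lemma power_grid_pos: "0 < power_grid a n"
  by (simp add: power_grid_def)

text \<open>The two conditions on \<open>a\<close> make \<open>sqrt \<epsilon>\<close> and
  \<open>\<epsilon> powr ((2 - \<alpha>) / 2)\<close> at most \<open>real (n + 2) powr - 2\<close>
  on the grid, so the variances are summable.\<close>

lemma (in fbm) average_tendsto_zero:
  fixes h :: "real \<Rightarrow> real"
  assumes h: "h \<in> borel_measurable borel" and K: "0 \<le> K"
    and sq: "\<And>\<epsilon> t. 0 < \<epsilon> \<Longrightarrow> 0 \<le> t \<Longrightarrow> integrable M (\<lambda>\<omega>. (h (Z \<epsilon> t \<omega>))\<^sup>2)"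
    and cov: "\<And>\<epsilon> s t. 0 < \<epsilon> \<Longrightarrow> 0 \<le> s \<Longrightarrow> 0 \<le> t \<Longrightarrow>
      \<bar>integral\<^sup>L M (\<lambda>\<omega>. h (Z \<epsilon> s \<omega>) * h (Z \<epsilon> t \<omega>))\<bar> \<le> K * \<bar>unit_increment_corr \<alpha> ((t - s) / \<epsilon>)\<bar>"
    and T: "0 < T" and a: "4 \<le> a" "4 \<le> a * (2 - \<alpha>)"
  shows "AE \<omega> in M. (\<lambda>n. LINT t|uniform_on T. h (Z (power_grid a n) (max 0 t) \<omega>)) \<longlonglongrightarrow> 0"
proof -
  let ?A = "\<lambda>n \<omega>. LINT t|uniform_on T. h (Z (power_grid a n) (max 0 t) \<omega>)"
  have small: "power_grid a n \<le> 1 / 4" for n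
  proof -
    have "power_grid a n \<le> real (n + 2) powr - 2"
      unfolding power_grid_def using a by (intro powr_mono) auto
    also have "\<dots> \<le> 2 powr - 2" by (intro powr_mono2') auto
    finally show ?thesis by (simp add: powr_minus)
  qed
  note * = average_variance_bound[OF h K sq cov power_grid_pos small T]
  have "summable (\<lambda>n. integral\<^sup>L M (\<lambda>\<omega>. (?A n \<omega>)\<^sup>2))"
  proof (rule summable_comparison_test[OF exI[of _ 0]], intro allI impI)
    show "summable (\<lambda>n. K * (2 / T + 4) * inverse (real (n + 2) ^ 2))"
      using summable_ignore_initial_segment[OF inverse_power_summable[of 2, where 'a = real], of 2]
      by (intro summable_mult) simp
    fix n
    let ?e = "power_grid a n"
    have e2: "inverse (real (n + 2) ^ 2) = real (n + 2) powr - 2"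
      by (simp add: powr_minus)
    have 1: "sqrt ?e \<le> real (n + 2) powr - 2"
    proof -
      have "sqrt ?e = real (n + 2) powr (- a / 2)"
        using power_grid_pos[of a n] by (simp add: power_grid_def powr_powr flip: powr_half_sqrt)
      also have "\<dots> \<le> real (n + 2) powr - 2" using a by (intro powr_mono) auto
      finally show ?thesis .
    qed
    have 2: "?e powr ((2 - \<alpha>) / 2) \<le> real (n + 2) powr - 2"
    proof -
      have "?e powr ((2 - \<alpha>) / 2) = real (n + 2) powr (- (a * (2 - \<alpha>) / 2))"
        by (simp add: power_grid_def powr_powr)
      also have "\<dots> \<le> real (n + 2) powr - 2" using a by (intro powr_mono) auto
      finally show ?thesis .
    qed
    have "integral\<^sup>L M (\<lambda>\<omega>. (?A n \<omega>)\<^sup>2) \<le> K * (2 / T * sqrt ?e + 4 * ?e powr ((2 - \<alpha>) / 2))"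
      by (rule *(2))
    also have "\<dots> \<le> K * (2 / T * real (n + 2) powr - 2 + 4 * real (n + 2) powr - 2)"
      using K T 1 2 by (intro mult_left_mono add_mono) auto
    also have "\<dots> = K * (2 / T + 4) * inverse (real (n + 2) ^ 2)"
      unfolding e2 by (simp add: algebra_simps)
    finally show "norm (integral\<^sup>L M (\<lambda>\<omega>. (?A n \<omega>)\<^sup>2)) \<le> K * (2 / T + 4) * inverse (real (n + 2) ^ 2)"
      by simp
  qed
  then have "AE \<omega> in M. (\<lambda>n. (?A n \<omega>)\<^sup>2) \<longlonglongrightarrow> 0"
    by (intro AE_LIMSEQ_zero_of_summable_integral *(1)) auto
  then show ?thesis
    by eventually_elim (simp add: tendsto_null_power)
qed

section \<open>From cosine averages to empirical distribution functions\<close>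

lemma abs_cos_diff_le: "\<bar>cos x - cos y\<bar> \<le> \<bar>x - y\<bar>" for x y :: real
proof -
  have "\<bar>cos x - cos y\<bar> = 2 * \<bar>sin ((x + y) / 2)\<bar> * \<bar>sin ((y - x) / 2)\<bar>"
    by (simp add: cos_diff_cos abs_mult)
  also have "\<dots> \<le> 2 * 1 * \<bar>(y - x) / 2\<bar>"
    by (intro mult_mono abs_sin_x_le_abs_x) auto
  finally show ?thesis by simp
qed

text \<open>A three-epsilon argument used for two families: empirical characteristic functions, in
  the frequency, and measures of sublevel sets, in the right end point of the time interval.\<close>

lemma LIMSEQ_of_dense_equi_lipschitz:
  fixes f :: "nat \<Rightarrow> real \<Rightarrow> real"
  assumes lim: "\<And>q. q \<in> \<rat> \<Longrightarrow> (\<lambda>n. f n q) \<longlonglongrightarrow> g q"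
    and lip: "\<forall>\<^sub>F n in sequentially. \<forall>u v. \<bar>f n u - f n v\<bar> \<le> L * \<bar>u - v\<bar>" and L: "0 < L"
    and g: "isCont g u"
  shows "(\<lambda>n. f n u) \<longlonglongrightarrow> g u"
proof (rule tendstoI)
  fix e :: real assume "0 < e"
  then obtain d where d: "0 < d" "\<And>v. \<bar>v - u\<bar> < d \<Longrightarrow> \<bar>g v - g u\<bar> < e / 3"
    using g unfolding continuous_at_eps_delta dist_real_def by (metis zero_less_divide_iff zero_less_numeral)
  obtain q where q: "q \<in> \<rat>" "u < q" "q < u + min d (e / (3 * L))"
    using Rats_dense_in_real[of u "u + min d (e / (3 * L))"] d L \<open>0 < e\<close> by auto
  have "q - u < e / (3 * L)" using q by simp
  then have "L * (q - u) < e / 3" using L by (simp add: field_simps)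
  then have 1: "L * \<bar>u - q\<bar> < e / 3" using q by simp
  have 2: "\<bar>g q - g u\<bar> < e / 3" using q by (intro d(2)) auto
  have "\<forall>\<^sub>F n in sequentially. dist (f n q) (g q) < e / 3"
    using lim[OF q(1)] \<open>0 < e\<close> by (intro tendstoD) auto
  then show "\<forall>\<^sub>F n in sequentially. dist (f n u) (g u) < e"
    using lip
  proof eventually_elim
    case (elim n)
    have "\<bar>f n u - f n q\<bar> \<le> L * \<bar>u - q\<bar>" using elim by blast
    with elim(1) 1 2 show ?case unfolding dist_real_def by linarith
  qed
qed

text \<open>Here \<open>N\<close> stands for time and \<open>X n\<close> for the increments of one
  fixed path. The hypotheses amount to countably many convergences, and the conclusion then covers
  all levels \<open>x\<close> without a further null set.\<close>

lemma measure_conv_of_cos_moments: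
  fixes X :: "nat \<Rightarrow> 'b \<Rightarrow> real"
  assumes "prob_space N"
    and X[measurable]: "\<And>n. X n \<in> borel_measurable N"
    and sq: "\<And>n. integrable N (\<lambda>t. (X n t)\<^sup>2)"
    and sq_lim: "(\<lambda>n. LINT t|N. (X n t)\<^sup>2 - 1) \<longlonglongrightarrow> 0"
    and cos_lim: "\<And>u \<theta>. u \<in> \<rat> \<Longrightarrow> \<theta> \<in> {0, pi / 2} \<Longrightarrow>
      (\<lambda>n. LINT t|N. cos (u * X n t - \<theta>) - cos \<theta> * exp (- u\<^sup>2 / 2)) \<longlonglongrightarrow> 0"
  shows "(\<lambda>n. measure N {t \<in> space N. X n t \<le> x}) \<longlonglongrightarrow> cdf std_normal_distribution x"
proof -
  interpret N: prob_space N by fact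
  have cosI: "integrable N (\<lambda>t. cos (u * X n t - \<theta>))" for u n \<theta>
    by (rule N.integrable_const_bound[where B=1]) auto
  have absI: "integrable N (X n)" for n
    by (rule N.square_integrable_imp_integrable[OF X sq])
  \<comment> \<open>The first absolute moment is a Lipschitz constant in the frequency. Second
    moments tend to 1, so they are eventually at most 2, and |y| \<le> 1 + y^2 gives the constant
    3.\<close>
  have lip: "\<forall>\<^sub>F n in sequentially. \<forall>u v. \<bar>(LINT t|N. cos (u * X n t - \<theta>)) - (LINT t|N. cos (v * X n t - \<theta>))\<bar> \<le> 3 * \<bar>u - v\<bar>" for \<theta>
  proof -
    have "\<forall>\<^sub>F n in sequentially. dist (LINT t|N. (X n t)\<^sup>2 - 1) 0 < 1"
      by (rule tendstoD[OF sq_lim]) simp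
    then show ?thesis
    proof eventually_elim
      case (elim n)
      then have le2: "(LINT t|N. (X n t)\<^sup>2) \<le> 2" using sq[of n] N.prob_space by (simp add: abs_le_iff)
      have "(LINT t|N. \<bar>X n t\<bar>) \<le> (LINT t|N. 1 + (X n t)\<^sup>2)"
      proof (rule integral_mono)
        fix t
        have "\<bar>y\<bar> \<le> 1 + y\<^sup>2" for y :: real
          using sum_squares_bound[of "\<bar>y\<bar>" 1] by simp
        then show "\<bar>X n t\<bar> \<le> 1 + (X n t)\<^sup>2" .
      qed (use absI sq in auto)
      then have le3: "(LINT t|N. \<bar>X n t\<bar>) \<le> 3" using le2 sq[of n] N.prob_space by simp
      show ?case
      proof (intro allI)
        fix u v
        have "\<bar>(LINT t|N. cos (u * X n t - \<theta>)) - (LINT t|N. cos (v * X n t - \<theta>))\<bar>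
          = \<bar>LINT t|N. cos (u * X n t - \<theta>) - cos (v * X n t - \<theta>)\<bar>"
          using cosI by simp
        also have "\<dots> \<le> (LINT t|N. \<bar>cos (u * X n t - \<theta>) - cos (v * X n t - \<theta>)\<bar>)"
          by (rule integral_abs_bound)
        also have "\<dots> \<le> (LINT t|N. \<bar>u - v\<bar> * \<bar>X n t\<bar>)"
        proof (rule integral_mono)
          fix t
          show "\<bar>cos (u * X n t - \<theta>) - cos (v * X n t - \<theta>)\<bar> \<le> \<bar>u - v\<bar> * \<bar>X n t\<bar>"
            using abs_cos_diff_le[of "u * X n t - \<theta>" "v * X n t - \<theta>"]
            by (simp flip: left_diff_distrib abs_mult)
        qed (use absI cosI in auto)
        also have "\<dots> \<le> \<bar>u - v\<bar> * 3"
          using le3 by (simp add: mult_left_mono)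
        finally show "\<bar>(LINT t|N. cos (u * X n t - \<theta>)) - (LINT t|N. cos (v * X n t - \<theta>))\<bar> \<le> 3 * \<bar>u - v\<bar>"
          by simp
      qed
    qed
  qed
  have lim: "(\<lambda>n. LINT t|N. cos (u * X n t - \<theta>)) \<longlonglongrightarrow> cos \<theta> * exp (- u\<^sup>2 / 2)"
    if \<theta>: "\<theta> \<in> {0, pi / 2}" for u \<theta>
  proof (rule LIMSEQ_of_dense_equi_lipschitz[OF _ lip])
    fix q :: real assume "q \<in> \<rat>"
    from cos_lim[OF this \<theta>] have "(\<lambda>n. (LINT t|N. cos (q * X n t - \<theta>)) - cos \<theta> * exp (- q\<^sup>2 / 2)) \<longlonglongrightarrow> 0"
      using cosI N.prob_space by simp
    then show "(\<lambda>n. LINT t|N. cos (q * X n t - \<theta>)) \<longlonglongrightarrow> cos \<theta> * exp (- q\<^sup>2 / 2)"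
      by (rule LIM_zero_cancel)
  next
    show "isCont (\<lambda>u. cos \<theta> * exp (- u\<^sup>2 / 2)) u" by (intro continuous_intros) auto
  qed simp
  have char_lim: "(\<lambda>n. char (distr N borel (X n)) u) \<longlonglongrightarrow> char std_normal_distribution u" for u
  proof -
    \<comment> \<open>The imaginary part is a sine, written as a cosine with phase
      \<open>pi / 2\<close>.\<close>
    have "char (distr N borel (X n)) u = complex_of_real (LINT t|N. cos (u * X n t - 0)) +
        \<i> * complex_of_real (LINT t|N. cos (u * X n t - pi / 2))" for n
    proof -
      have int: "integrable N (\<lambda>t. iexp (u * X n t))"
        by (rule N.integrable_iexp) auto
      have "char (distr N borel (X n)) u = (CLINT t|N. iexp (u * X n t))"
        unfolding char_def by (subst integral_distr) auto
      then have "Re (char (distr N borel (X n)) u) = (LINT t|N. Re (iexp (u * X n t)))"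
        "Im (char (distr N borel (X n)) u) = (LINT t|N. Im (iexp (u * X n t)))"
        by (simp_all only: integral_Re[OF int] integral_Im[OF int])
      then show ?thesis
        by (simp add: complex_eq_iff Re_exp Im_exp cos_diff)
    qed
    then have "(\<lambda>n. char (distr N borel (X n)) u) \<longlonglongrightarrow> complex_of_real (cos 0 * exp (- u\<^sup>2 / 2)) +
        \<i> * complex_of_real (cos (pi / 2) * exp (- u\<^sup>2 / 2))"
      by (simp only:) (intro tendsto_intros lim, auto)
    then show ?thesis by (simp add: char_std_normal_distribution)
  qed
  have "weak_conv_m (\<lambda>n. distr N borel (X n)) std_normal_distribution"
    by (rule levy_continuity[OF _ real_dist_normal_dist char_lim])
      (auto simp: real_distribution_def real_distribution_axioms_def intro!: N.prob_space_distr)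
  then have "(\<lambda>n. cdf (distr N borel (X n)) x) \<longlonglongrightarrow> cdf std_normal_distribution x"
    by (simp add: weak_conv_m_def weak_conv_def isCont_cdf_std_normal)
  moreover have "cdf (distr N borel (X n)) x = measure N {t \<in> space N. X n t \<le> x}" for n
    unfolding cdf_def by (subst measure_distr) (auto intro!: arg_cong[where f = "measure N"])
  ultimately show ?thesis by simp
qed

text \<open>Rational \<open>T\<close>, rational frequencies and two phases leave countably many
  almost sure convergences, so one null set serves them all.\<close>

lemma (in fbm) AE_increment_measure_conv_on_grid:
  assumes a: "4 \<le> a" "4 \<le> a * (2 - \<alpha>)"
  shows "AE \<omega> in M. \<forall>T\<in>\<rat> \<inter> {0<..}. \<forall>x.
    (\<lambda>n. measure (uniform_on T) {t. Z (power_grid a n) (max 0 t) \<omega> \<le> x}) \<longlonglongrightarrow> cdf std_normal_distribution x"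
proof -
  have sqAE: "AE \<omega> in M. (\<lambda>n. LINT t|uniform_on T. (Z (power_grid a n) (max 0 t) \<omega>)\<^sup>2 - 1) \<longlonglongrightarrow> 0"
    if "T \<in> \<rat> \<inter> {0<..}" for T
  proof (rule average_tendsto_zero[where h = "\<lambda>x. x\<^sup>2 - 1" and K = 2])
    fix \<epsilon> t :: real assume "0 < \<epsilon>" "0 \<le> t"
    then show "integrable M (\<lambda>\<omega>. ((Z \<epsilon> t \<omega>)\<^sup>2 - 1)\<^sup>2)"
      using centered_gaussian_moments(2)[OF Z_gaussian, of \<epsilon> t 2] centered_gaussian_moments(2)[OF Z_gaussian, of \<epsilon> t 4]
      by (simp add: power2_diff)
  qed (use that square_cov a in auto)
  have cosAE: "AE \<omega> in M. (\<lambda>n. LINT t|uniform_on T. cos (u * Z (power_grid a n) (max 0 t) \<omega> - \<theta>)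
      - cos \<theta> * exp (- u\<^sup>2 / 2)) \<longlonglongrightarrow> 0"
    if "T \<in> \<rat> \<inter> {0<..}" for T u \<theta>
  proof (rule average_tendsto_zero[where h = "\<lambda>x. cos (u * x - \<theta>) - cos \<theta> * exp (- u\<^sup>2 / 2)" and K = "u\<^sup>2"])
    fix \<epsilon> t :: real assume "0 < \<epsilon>" "0 \<le> t"
    note [measurable] = measurable_Z[OF this]
    have "\<bar>cos y - cos \<theta> * exp (- u\<^sup>2 / 2)\<bar> \<le> 2" for y
    proof -
      have "\<bar>cos \<theta> * exp (- u\<^sup>2 / 2)\<bar> \<le> 1 * 1"
        unfolding abs_mult by (intro mult_mono) auto
      then show ?thesis using abs_cos_le_one[of y] by linarith
    qed
    then have "\<bar>cos y - cos \<theta> * exp (- u\<^sup>2 / 2)\<bar>\<^sup>2 \<le> 2\<^sup>2" for y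
      by (intro power_mono) auto
    then show "integrable M (\<lambda>\<omega>. (cos (u * Z \<epsilon> t \<omega> - \<theta>) - cos \<theta> * exp (- u\<^sup>2 / 2))\<^sup>2)"
      by (intro integrable_const_bound[where B = "2\<^sup>2"]) auto
  qed (use that cos_cov a in auto)
  have countable: "countable (\<rat> \<inter> {0<..} :: real set)" "countable (\<rat> :: real set)"
    by (auto intro: countable_rat countable_subset[OF Int_lower1])
  have "AE \<omega> in M. \<forall>T\<in>\<rat> \<inter> {0<..}. (\<lambda>n. LINT t|uniform_on T. (Z (power_grid a n) (max 0 t) \<omega>)\<^sup>2 - 1) \<longlonglongrightarrow> 0"
    using sqAE by (subst AE_ball_countable[OF countable(1)]) blast
  moreover have "AE \<omega> in M. \<forall>T\<in>\<rat> \<inter> {0<..}. \<forall>u\<in>\<rat>. \<forall>\<theta>\<in>{0, pi / 2}.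
      (\<lambda>n. LINT t|uniform_on T. cos (u * Z (power_grid a n) (max 0 t) \<omega> - \<theta>) - cos \<theta> * exp (- u\<^sup>2 / 2)) \<longlonglongrightarrow> 0"
    by (intro AE_ball_countable[OF countable(1), THEN iffD2] AE_ball_countable[OF countable(2), THEN iffD2]
        AE_ball_countable[OF countable_finite, THEN iffD2] ballI cosAE) auto
  ultimately show ?thesis using AE_space
  proof eventually_elim
    case (elim \<omega>)
    show ?case
    proof (intro ballI allI)
      fix T :: real and x assume T: "T \<in> \<rat> \<inter> {0<..}"
      have c: "continuous_on UNIV (\<lambda>t. Z (power_grid a n) (max 0 t) \<omega>)" for n
        using elim by (intro continuous_Z power_grid_pos)
      have "(\<lambda>n. measure (uniform_on T) {t \<in> space (uniform_on T). Z (power_grid a n) (max 0 t) \<omega> \<le> x})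
          \<longlonglongrightarrow> cdf std_normal_distribution x"
      proof (rule measure_conv_of_cos_moments[OF prob_space_uniform_on])
        show "0 < T" using T by simp
        show "(\<lambda>t. Z (power_grid a n) (max 0 t) \<omega>) \<in> borel_measurable (uniform_on T)" for n
          using borel_measurable_continuous_onI[OF c] by simp
        show "integrable (uniform_on T) (\<lambda>t. (Z (power_grid a n) (max 0 t) \<omega>)\<^sup>2)" for n
          using T by (intro integrable_uniform_on continuous_on_power c) auto
      qed (use T elim(1,2) in blast)+
      then show "(\<lambda>n. measure (uniform_on T) {t. Z (power_grid a n) (max 0 t) \<omega> \<le> x}) \<longlonglongrightarrow> cdf std_normal_distribution x"
        by simp
    qed
  qed
qed

section \<open>Hoelder continuity of paths\<close>

text \<open>Chaining as in Kolmogorov's continuity criterion: the dyadic approximations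
  \<open>d i\<close> of \<open>t\<close> from below converge to \<open>t\<close>, and refining the
  level moves them by at most one step of the finer level. The increments along the chain are
  dominated by a geometric series.\<close>

lemma dyadic_approximation:
  fixes f :: "real \<Rightarrow> real"
  assumes cont: "continuous_on {0..} f" and r: "0 < r" "r < 1"
    and inc: "\<And>k j. k0 \<le> k \<Longrightarrow> j < N * 2 ^ k \<Longrightarrow> \<bar>f (real (Suc j) / 2 ^ k) - f (real j / 2 ^ k)\<bar> \<le> r ^ k"
    and k: "k0 \<le> k" and t: "0 \<le> t" "t < real N"
  shows "\<bar>f t - f (real (nat \<lfloor>2 ^ k * t\<rfloor>) / 2 ^ k)\<bar> \<le> r ^ k / (1 - r)"
proof -
  define m where "m i = nat \<lfloor>2 ^ i * t\<rfloor>" for i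
  define d where "d i = real (m i) / 2 ^ i" for i
  have m: "real (m i) \<le> 2 ^ i * t" "2 ^ i * t < real (m i) + 1" for i
    using t unfolding m_def by (auto simp: of_nat_nat)
  have step: "\<bar>f (d (Suc i)) - f (d i)\<bar> \<le> r ^ i" if "k0 \<le> i" for i
  proof -
    have "real (m (Suc i)) < real (2 * m i + 2)" "real (2 * m i) < real (m (Suc i) + 1)"
      using m[of i] m[of "Suc i"] by auto
    then have "m (Suc i) = 2 * m i \<or> m (Suc i) = Suc (2 * m i)"
      unfolding of_nat_less_iff by linarith
    then show ?thesis
    proof
      assume "m (Suc i) = 2 * m i"
      then show ?thesis using r by (simp add: d_def)
    next
      \<comment> \<open>The point \<open>d i\<close> is the one with index \<open>2 * m i\<close> at
        the finer level. The strict bound \<open>t < real N\<close> keeps this index in the range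
        covered by \<open>inc\<close>.\<close>
      assume *: "m (Suc i) = Suc (2 * m i)"
      have "2 ^ i * t < 2 ^ i * real N" using t by simp
      then have "real (m i) < real (N * 2 ^ i)"
        using m(1)[of i] unfolding of_nat_mult of_nat_power of_nat_numeral mult.commute[of "real N"]
        by linarith
      then have "2 * m i < N * 2 ^ Suc i" unfolding of_nat_less_iff by simp
      from inc[OF _ this] that have "\<bar>f (real (Suc (2 * m i)) / 2 ^ Suc i) - f (real (2 * m i) / 2 ^ Suc i)\<bar> \<le> r ^ Suc i"
        by simp
      also have "\<dots> \<le> r ^ i" using r by (intro power_decreasing) auto
      finally show ?thesis using * by (simp add: d_def)
    qed
  qed
  have bound: "\<bar>f (d (k + n)) - f (d k)\<bar> \<le> r ^ k * ((1 - r ^ n) / (1 - r))" for n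
  proof (induction n)
    case (Suc n)
    have "\<bar>f (d (k + Suc n)) - f (d k)\<bar> \<le> r ^ k * ((1 - r ^ n) / (1 - r)) + r ^ (k + n)"
      using Suc step[of "k + n"] k by simp
    also have "\<dots> = r ^ k * ((1 - r ^ n) / (1 - r) + r ^ n)"
      by (simp add: power_add distrib_left)
    also have "(1 - r ^ n) / (1 - r) + r ^ n = (1 - r ^ Suc n) / (1 - r)"
      using r by (simp add: field_simps)
    finally show ?case .
  qed simp
  have "d \<longlonglongrightarrow> t"
  proof (rule tendsto_sandwich)
    show "(\<lambda>i. t - (1 / 2) ^ i) \<longlonglongrightarrow> t"
      using tendsto_diff[OF tendsto_const LIMSEQ_power_zero[of "1/2 :: real"], of t] by simp
    show "\<forall>\<^sub>F i in sequentially. t - (1 / 2) ^ i \<le> d i"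
    proof (intro always_eventually allI)
      fix i
      have "t \<le> (real (m i) + 1) / 2 ^ i"
        using m(2)[of i] by (simp add: pos_le_divide_eq mult.commute)
      then show "t - (1 / 2) ^ i \<le> d i" by (simp add: d_def add_divide_distrib power_one_over)
    qed
    show "\<forall>\<^sub>F i in sequentially. d i \<le> t"
      using m(1) by (intro always_eventually allI) (simp add: d_def field_simps)
  qed simp
  moreover have "0 \<le> d i" for i by (simp add: d_def)
  ultimately have "(\<lambda>i. f (d i)) \<longlonglongrightarrow> f t"
    using t by (intro continuous_on_tendsto_compose[OF cont]) auto
  then have "(\<lambda>n. \<bar>f (d (n + k)) - f (d k)\<bar>) \<longlonglongrightarrow> \<bar>f t - f (d k)\<bar>"
    by (intro tendsto_intros LIMSEQ_ignore_initial_segment)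
  moreover have "\<bar>f (d (n + k)) - f (d k)\<bar> \<le> r ^ k / (1 - r)" for n
  proof -
    have "r ^ k * ((1 - r ^ n) / (1 - r)) \<le> r ^ k * (1 / (1 - r))"
      using r by (intro mult_left_mono divide_right_mono) auto
    with bound[of n] show ?thesis by (simp add: add.commute)
  qed
  ultimately have "\<bar>f t - f (d k)\<bar> \<le> r ^ k / (1 - r)"
    by (intro LIMSEQ_le_const2) auto
  then show ?thesis by (simp add: d_def m_def)
qed

text \<open>Two such points lie in the same or in adjacent dyadic cells of level \<open>k\<close>:
  two chains, each costing at most \<open>r ^ k / (1 - r)\<close>, and at most one step between the
  cells.\<close>

lemma dyadic_modulus:
  fixes f :: "real \<Rightarrow> real"
  assumes cont: "continuous_on {0..} f" and r: "0 < r" "r < 1"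
    and inc: "\<And>k j. k0 \<le> k \<Longrightarrow> j < N * 2 ^ k \<Longrightarrow> \<bar>f (real (Suc j) / 2 ^ k) - f (real j / 2 ^ k)\<bar> \<le> r ^ k"
    and k: "k0 \<le> k" and st: "s \<in> {0..<real N}" "t \<in> {0..<real N}" "\<bar>s - t\<bar> \<le> 1 / 2 ^ k"
  shows "\<bar>f s - f t\<bar> \<le> (2 / (1 - r) + 1) * r ^ k"
proof -
  have *: "\<bar>f s - f t\<bar> \<le> (2 / (1 - r) + 1) * r ^ k"
    if st: "0 \<le> s" "s \<le> t" "t < real N" "t - s \<le> 1 / 2 ^ k" for s t
  proof -
    define m where "m = nat \<lfloor>2 ^ k * s\<rfloor>"
    define m' where "m' = nat \<lfloor>2 ^ k * t\<rfloor>"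
    have m: "real m \<le> 2 ^ k * s" "2 ^ k * s < real m + 1" "real m' \<le> 2 ^ k * t" "2 ^ k * t < real m' + 1"
      using st unfolding m_def m'_def by (auto simp: of_nat_nat)
    have st2: "2 ^ k * s \<le> 2 ^ k * t" "2 ^ k * t \<le> 2 ^ k * s + 1" "2 ^ k * t < 2 ^ k * real N"
      using st by (auto simp: field_simps)
    have "real m < real m' + 1" "real m' < real m + 2" using m st2 by linarith+
    then have "real m < real (m' + 1)" "real m' < real (m + 2)" by simp_all
    moreover have "real m < real (N * 2 ^ k)"
      using m st2 unfolding of_nat_mult of_nat_power of_nat_numeral mult.commute[of "real N"] by linarith
    ultimately have mm: "m' = m \<or> m' = Suc m" "m < N * 2 ^ k"
      unfolding of_nat_less_iff by linarith+
    then have "\<bar>f (real m' / 2 ^ k) - f (real m / 2 ^ k)\<bar> \<le> r ^ k"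
      using inc[OF k, of m] r by auto
    moreover have "\<bar>f s - f (real m / 2 ^ k)\<bar> \<le> r ^ k / (1 - r)"
      unfolding m_def using st by (intro dyadic_approximation[OF cont r inc k]) auto
    moreover have "\<bar>f t - f (real m' / 2 ^ k)\<bar> \<le> r ^ k / (1 - r)"
      unfolding m'_def using st by (intro dyadic_approximation[OF cont r inc k]) auto
    ultimately have "\<bar>f s - f t\<bar> \<le> 2 * (r ^ k / (1 - r)) + r ^ k" by linarith
    then show ?thesis by (simp add: algebra_simps)
  qed
  show ?thesis
    using *[of s t] *[of t s] st by (cases "s \<le> t") (auto simp: abs_minus_commute)
qed

text \<open>The bound is in terms of any \<open>h\<close> that dominates the distance, since the
  interpolation knows only an upper bound on the gap between grid points. The time interval is
  half-open, as dyadic cells are.\<close>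

definition locally_holder :: "(real \<Rightarrow> real) \<Rightarrow> real \<Rightarrow> real \<Rightarrow> bool" where
  "locally_holder f \<gamma> T \<longleftrightarrow> (\<exists>C h0. 0 < h0 \<and>
     (\<forall>h s t. 0 < h \<and> h \<le> h0 \<and> s \<in> {0..<T} \<and> t \<in> {0..<T} \<and> \<bar>s - t\<bar> \<le> h \<longrightarrow> \<bar>f s - f t\<bar> \<le> C * h powr \<gamma>))"

lemma dyadic_holder:
  fixes f :: "real \<Rightarrow> real"
  assumes cont: "continuous_on {0..} f" and \<gamma>: "0 < \<gamma>"
    and inc: "\<And>k j. k0 \<le> k \<Longrightarrow> j < N * 2 ^ k \<Longrightarrow>
      \<bar>f (real (Suc j) / 2 ^ k) - f (real j / 2 ^ k)\<bar> \<le> (2 powr - \<gamma>) ^ k"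
  shows "locally_holder f \<gamma> (real N)"
proof -
  define r where "r = 2 powr - \<gamma>"
  have r: "0 < r" "r < 1" using \<gamma> by (auto simp: r_def powr_minus powr_less_one field_simps)
  \<comment> \<open>The factor \<open>2 powr \<gamma>\<close> pays for rounding \<open>h\<close> up
    to a power of \<open>1 / 2\<close>, which is below \<open>2 * h\<close>.\<close>
  define C where "C = (2 / (1 - r) + 1) * 2 powr \<gamma>"
  have "\<bar>f s - f t\<bar> \<le> C * h powr \<gamma>"
    if h: "0 < h" "h \<le> (1 / 2) ^ k0" and st: "s \<in> {0..<real N}" "t \<in> {0..<real N}" "\<bar>s - t\<bar> \<le> h" for h s t
  proof -
    obtain n where "(1 / 2) ^ n < h" using real_arch_pow_inv[OF h(1), of "1/2"] by auto
    \<comment> \<open>Minimality puts \<open>h\<close> between \<open>(1 / 2) ^ n\<close> and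
      \<open>(1 / 2) ^ (n - 1)\<close>.\<close>
    define n where "n = (LEAST n. (1 / 2 :: real) ^ n < h)"
    have n: "(1 / 2) ^ n < h" unfolding n_def by (rule LeastI) fact
    have nk: "k0 < n"
    proof (rule ccontr)
      assume "\<not> k0 < n"
      then have "(1 / 2 :: real) ^ k0 \<le> (1 / 2) ^ n" by (intro power_decreasing) auto
      with n h show False by simp
    qed
    define k where "k = n - 1"
    have k: "n = Suc k" "k0 \<le> k" using nk by (auto simp: k_def)
    have hk: "h \<le> (1 / 2) ^ k" using not_less_Least[of k "\<lambda>n. (1 / 2 :: real) ^ n < h"] k by (simp add: n_def)
    have "\<bar>f s - f t\<bar> \<le> (2 / (1 - r) + 1) * r ^ k"
      using hk st inc by (intro dyadic_modulus[OF cont r _ k(2)]) (auto simp: r_def power_one_over)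
    also have "r ^ k \<le> 2 powr \<gamma> * h powr \<gamma>"
    proof -
      have "r ^ k = ((1 / 2) ^ k) powr \<gamma>"
        by (simp add: r_def powr_powr flip: powr_realpow powr_powr)
          (simp add: powr_divide powr_minus powr_powr inverse_eq_divide mult.commute)
      also have "\<dots> \<le> (2 * h) powr \<gamma>" using n k \<gamma> by (intro powr_mono2) auto
      finally show ?thesis using h by (simp add: powr_mult)
    qed
    finally show ?thesis using r by (simp add: C_def mult_left_mono mult.assoc)
  qed
  then show ?thesis unfolding locally_holder_def by (intro exI[of _ C] exI[of _ "(1 / 2) ^ k0"]) auto
qed

text \<open>The order \<open>2p\<close> is so large that the \<open>2p\<close>-th powers of the \<open>N 2\<^sup>k\<close> level-\<open>k\<close> increments, rescaled by
  \<open>2 powr (\<gamma> k)\<close>, have a total expectation decaying geometrically in \<open>k\<close>.\<close>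

lemma (in fbm) AE_dyadic_increments:
  assumes \<gamma>: "0 < \<gamma>" "\<gamma> < \<alpha> / 2"
  shows "AE \<omega> in M. \<forall>\<^sub>F k in sequentially. \<forall>j < N * 2 ^ k.
    \<bar>B (real (Suc j) / 2 ^ k) \<omega> - B (real j / 2 ^ k) \<omega>\<bar> \<le> (2 powr - \<gamma>) ^ k"
proof -
  \<comment> \<open>A rescaled increment has moment of order \<open>2 * p\<close> equal to a
    constant times \<open>2 powr (- 2 * k * p * (\<alpha> / 2 - \<gamma>))\<close>. With
    \<open>p * (\<alpha> / 2 - \<gamma>)\<close> at least 1, summing \<open>N * 2 ^ k\<close> of
    them leaves a multiple of \<open>(1 / 2) ^ k\<close>.\<close>
  define p where "p = nat \<lceil>1 / (\<alpha> / 2 - \<gamma>)\<rceil>"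
  have "1 / (\<alpha> / 2 - \<gamma>) \<le> real p" unfolding p_def by linarith
  then have p: "1 \<le> real p * (\<alpha> / 2 - \<gamma>)" using \<gamma> by (simp add: field_simps)
  define \<Delta> where "\<Delta> k j \<omega> = B (real (Suc j) / 2 ^ k) \<omega> - B (real j / 2 ^ k) \<omega>" for k j \<omega>
  define r where "r = 2 powr - \<gamma>"
  have r: "0 < r" by (simp add: r_def)
  define X where "X k \<omega> = (\<Sum>j<N * 2 ^ k. \<Delta> k j \<omega> ^ (2 * p) / r ^ (k * (2 * p)))" for k \<omega>
  define c where "c = real N * (fact (2 * p) / (2 ^ p * fact p))"
  have "0 \<le> c" by (simp add: c_def)
  have g: "centered_gaussian M (\<Delta> k j) ((1 / 2 ^ k) powr \<alpha>)" for k j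
    using B_increment_gaussian[of "real j / 2 ^ k" "real (Suc j) / 2 ^ k"]
    by (simp add: \<Delta>_def[abs_def] flip: diff_divide_distrib)
  note i = centered_gaussian_moments(2)[OF g]
  have X_int: "integrable M (X k)" for k
    unfolding X_def[abs_def] using i by auto
  have EX: "integral\<^sup>L M (X k) \<le> c * (1 / 2) ^ k" for k
  proof -
    have "integral\<^sup>L M (X k) = real (N * 2 ^ k) * (((1 / 2 ^ k) powr \<alpha>) ^ p * (fact (2 * p) / (2 ^ p * fact p)) / r ^ (k * (2 * p)))"
      unfolding X_def[abs_def] using i by (simp add: centered_gaussian_moments(1)[OF g])
    also have "\<dots> = c * (2 ^ k * ((1 / 2 ^ k) powr \<alpha>) ^ p / r ^ (k * (2 * p)))"
      by (simp add: c_def)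
    also have "2 ^ k * ((1 / 2 ^ k) powr \<alpha>) ^ p / r ^ (k * (2 * p)) = 2 powr (real k * (1 - 2 * (real p * (\<alpha> / 2 - \<gamma>))))"
    proof -
      have 1: "(2::real) ^ k = 2 powr (real k)" by (simp add: powr_realpow)
      have "(1 / 2 ^ k :: real) = 2 powr (- real k)" by (simp add: powr_minus powr_realpow inverse_eq_divide)
      then have 2: "((1 / 2 ^ k) powr \<alpha>) ^ p = 2 powr (- real k * \<alpha> * real p)"
        by (simp add: powr_powr flip: powr_realpow)
      have 3: "r ^ (k * (2 * p)) = 2 powr (- \<gamma> * (real k * (2 * real p)))"
        by (simp add: r_def powr_powr flip: powr_realpow)
      show ?thesis unfolding 2 3 unfolding 1
        by (simp add: algebra_simps flip: powr_add powr_diff)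
    qed
    also have "\<dots> \<le> 2 powr (real k * (-1))"
      using p by (intro powr_mono mult_left_mono) auto
    also have "2 powr (real k * (-1)) = (1 / 2) ^ k"
      by (simp add: powr_minus powr_realpow power_one_over inverse_eq_divide)
    finally show ?thesis by (simp add: mult_left_mono \<open>0 \<le> c\<close>)
  qed
  have X_nonneg: "0 \<le> X k \<omega>" for k \<omega>
    unfolding X_def using r by (intro sum_nonneg) (auto simp: power_mult)
  have "summable (\<lambda>k. integral\<^sup>L M (X k))"
  proof (rule summable_comparison_test[OF exI[of _ 0]], intro allI impI)
    show "summable (\<lambda>k. c * (1 / 2) ^ k)" by (intro summable_mult summable_geometric) simp
    show "norm (integral\<^sup>L M (X k)) \<le> c * (1 / 2) ^ k" for k
      using EX[of k] X_nonneg by (simp add: integral_nonneg_AE)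
  qed
  then have "AE \<omega> in M. (\<lambda>k. X k \<omega>) \<longlonglongrightarrow> 0"
    by (rule AE_LIMSEQ_zero_of_summable_integral[OF X_int X_nonneg])
  then show ?thesis
  proof eventually_elim
    case (elim \<omega>)
    have "\<forall>\<^sub>F k in sequentially. X k \<omega> < 1" by (rule order_tendstoD[OF elim]) simp
    then show ?case
    proof eventually_elim
      case (elim k)
      show ?case
      proof (intro allI impI)
        fix j assume j: "j < N * 2 ^ k"
        have "\<Delta> k j \<omega> ^ (2 * p) / r ^ (k * (2 * p)) \<le> X k \<omega>"
          unfolding X_def using j r by (intro member_le_sum) (auto simp: power_mult)
        with elim have "\<Delta> k j \<omega> ^ (2 * p) / r ^ (k * (2 * p)) \<le> 1" by simp
        then have "\<Delta> k j \<omega> ^ (2 * p) \<le> r ^ (k * (2 * p))" using r by (simp add: pos_divide_le_eq)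
        then have "\<bar>\<Delta> k j \<omega>\<bar> ^ (2 * p) \<le> (r ^ k) ^ (2 * p)"
          by (simp add: power_mult)
        moreover have "p > 0" using p by (cases p) auto
        ultimately have "\<bar>\<Delta> k j \<omega>\<bar> \<le> r ^ k"
          using r by (subst (asm) power_mono_iff) auto
        then show "\<bar>B (real (Suc j) / 2 ^ k) \<omega> - B (real j / 2 ^ k) \<omega>\<bar> \<le> (2 powr - \<gamma>) ^ k"
          by (simp add: \<Delta>_def r_def)
      qed
    qed
  qed
qed

lemma (in fbm) AE_holder:
  assumes \<gamma>: "0 < \<gamma>" "\<gamma> < \<alpha> / 2"
  shows "AE \<omega> in M. \<forall>N::nat. locally_holder (\<lambda>t. B t \<omega>) \<gamma> (real N)"
proof -
  have "AE \<omega> in M. locally_holder (\<lambda>t. B t \<omega>) \<gamma> (real N)" for N :: nat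
    using AE_dyadic_increments[OF \<gamma>, of N] AE_space
  proof eventually_elim
    case (elim \<omega>)
    then obtain k0 where "\<And>k j. k0 \<le> k \<Longrightarrow> j < N * 2 ^ k \<Longrightarrow>
        \<bar>B (real (Suc j) / 2 ^ k) \<omega> - B (real j / 2 ^ k) \<omega>\<bar> \<le> (2 powr - \<gamma>) ^ k"
      by (auto simp: eventually_sequentially)
    from dyadic_holder[OF continuous_B[OF elim(2)] \<gamma>(1) this]
    show ?case .
  qed
  then show ?thesis by (simp add: AE_all_countable)
qed

section \<open>Interpolation between grid points\<close>

definition scaled_increment :: "real \<Rightarrow> (real \<Rightarrow> real) \<Rightarrow> real \<Rightarrow> real \<Rightarrow> real" where
  "scaled_increment \<alpha> f \<epsilon> t = \<epsilon> powr (- \<alpha> / 2) * (f (t + \<epsilon>) - f t)"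

text \<open>Solving \<open>\<epsilon> = y powr - a\<close> for \<open>y\<close> and rounding down
  gives the base of the next larger grid point; subtracting 2 undoes the shift in
  \<open>power_grid\<close>. Truncation of the subtraction is harmless once \<open>y\<close> is at
  least 2.\<close>

definition grid_index :: "real \<Rightarrow> real \<Rightarrow> nat" where
  "grid_index a \<epsilon> = nat \<lfloor>\<epsilon> powr (- 1 / a)\<rfloor> - 2"

lemma powr_neg_filterlim:
  assumes "0 < (a::real)"
  shows "filterlim (\<lambda>\<epsilon>. \<epsilon> powr (- 1 / a)) at_top (at_right 0)"
  using assms by real_asymp

lemma grid_index_at_top:
  assumes "0 < a"
  shows "filterlim (grid_index a) at_top (at_right 0)"
proof -
  have "filterlim (\<lambda>y::real. nat \<lfloor>y\<rfloor> - 2) at_top at_top"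
    unfolding filterlim_at_top
  proof
    fix n :: nat
    show "\<forall>\<^sub>F y in at_top. n \<le> nat \<lfloor>y::real\<rfloor> - 2"
      using eventually_ge_at_top[of "real (n + 2)"] by eventually_elim linarith
  qed
  from filterlim_compose[OF this powr_neg_filterlim[OF assms]] show ?thesis
    unfolding grid_index_def[abs_def] .
qed

text \<open>With \<open>y = \<epsilon> powr (- 1 / a)\<close> and \<open>m\<close> its integer part,
  the comparison is between \<open>y powr - a\<close> and \<open>m powr - a\<close>. The mean value
  theorem bounds the gap, the intermediate point exceeding \<open>m > y - 1 \<ge> y / 2\<close>; the
  ratio is \<open>(y / m) powr a\<close>.\<close>

lemma power_grid_index:
  fixes a \<epsilon> :: real
  assumes a: "0 < a" and \<epsilon>: "0 < \<epsilon>" and y: "2 \<le> \<epsilon> powr (- 1 / a)"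
  defines "e \<equiv> power_grid a (grid_index a \<epsilon>)"
  shows "\<epsilon> \<le> e" "e - \<epsilon> \<le> a * (\<epsilon> powr (- 1 / a) / 2) powr (- a - 1)"
    "e / \<epsilon> \<le> (\<epsilon> powr (- 1 / a) / (\<epsilon> powr (- 1 / a) - 1)) powr a"
proof -
  define y where "y = \<epsilon> powr (- 1 / a)"
  define m where "m = real (nat \<lfloor>y\<rfloor>)"
  have y2: "2 \<le> \<lfloor>y\<rfloor>" using y by (simp add: y_def le_floor_iff)
  then have "m = of_int \<lfloor>y\<rfloor>" unfolding m_def by (simp add: of_nat_nat)
  with y2 have m: "2 \<le> m" "m \<le> y" "y < m + 1" by simp_all
  have \<epsilon>y: "\<epsilon> = y powr - a" using a \<epsilon> by (simp add: y_def powr_powr)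
  have "nat \<lfloor>y\<rfloor> - 2 + 2 = nat \<lfloor>y\<rfloor>" using y2 by linarith
  then have em: "e = m powr - a"
    unfolding e_def power_grid_def grid_index_def m_def y_def[symmetric] by simp
  show "\<epsilon> \<le> e" unfolding \<epsilon>y em using m a by (intro powr_mono2') auto
  show "e - \<epsilon> \<le> a * (\<epsilon> powr (- 1 / a) / 2) powr (- a - 1)"
  proof (cases "m = y")
    case True
    then show ?thesis using a unfolding \<epsilon>y em by simp
  next
    case False
    with m have "m < y" by simp
    have "\<exists>z. m < z \<and> z < y \<and> y powr - a - m powr - a = (y - m) * (- a * z powr (- a - 1))"
      using \<open>m < y\<close> m by (intro MVT2 has_real_derivative_powr) auto
    then obtain z where z: "m < z" "z < y" "m powr - a - y powr - a = (y - m) * (a * z powr (- a - 1))"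
      by (auto simp: algebra_simps)
    have "(y - m) * (a * z powr (- a - 1)) \<le> 1 * (a * (y / 2) powr (- a - 1))"
    proof (intro mult_mono powr_mono2')
      show "y / 2 \<le> z" using m z by simp
    qed (use m z a in auto)
    with z(3) show ?thesis unfolding em \<epsilon>y[symmetric] y_def[symmetric] by simp
  qed
  have "e / \<epsilon> = m powr - a / y powr - a" by (simp only: em \<epsilon>y)
  also have "\<dots> = (y / m) powr a"
    using m by (simp add: powr_divide powr_minus field_simps)
  also have "\<dots> \<le> (y / (y - 1)) powr a"
    using m a by (intro powr_mono2 divide_left_mono) auto
  finally show "e / \<epsilon> \<le> (\<epsilon> powr (- 1 / a) / (\<epsilon> powr (- 1 / a) - 1)) powr a"
    by (simp add: y_def)
qed

lemma power_grid_index_ratio: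
  assumes a: "0 < a"
  shows "((\<lambda>\<epsilon>. power_grid a (grid_index a \<epsilon>) / \<epsilon>) \<longlongrightarrow> 1) (at_right 0)"
proof (rule tendsto_sandwich)
  have ev: "\<forall>\<^sub>F \<epsilon> in at_right 0. 2 \<le> \<epsilon> powr (- 1 / a)"
    using powr_neg_filterlim[OF a] by (simp add: filterlim_at_top)
  have pos: "\<forall>\<^sub>F \<epsilon> in at_right (0::real). 0 < \<epsilon>" by (rule eventually_at_right_less)
  show "\<forall>\<^sub>F \<epsilon> in at_right 0. 1 \<le> power_grid a (grid_index a \<epsilon>) / \<epsilon>"
    using ev pos by eventually_elim (use power_grid_index(1)[OF a] in simp)
  show "\<forall>\<^sub>F \<epsilon> in at_right 0. power_grid a (grid_index a \<epsilon>) / \<epsilon>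
      \<le> (\<epsilon> powr (- 1 / a) / (\<epsilon> powr (- 1 / a) - 1)) powr a"
    using ev pos by eventually_elim (rule power_grid_index(3)[OF a])
  have "((\<lambda>y::real. y / (y - 1)) \<longlongrightarrow> 1) at_top" by real_asymp
  from tendsto_powr[OF this tendsto_const, of a]
  have "((\<lambda>y::real. (y / (y - 1)) powr a) \<longlongrightarrow> 1) at_top" by simp
  from filterlim_compose[OF this powr_neg_filterlim[OF a]]
  show "((\<lambda>\<epsilon>. (\<epsilon> powr (- 1 / a) / (\<epsilon> powr (- 1 / a) - 1)) powr a) \<longlongrightarrow> 1) (at_right 0)" .
qed simp

text \<open>The factor in front of the increment at the grid point \<open>e\<close> gives both
  increments the prefactor \<epsilon> powr (- \<alpha> / 2). The value at \<open>t\<close> then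
  cancels, and only \<open>f (t + \<epsilon>) - f (t + e)\<close> is left for the Hoelder bound.
  Expressed in \<open>y\<close>, the error has exponent
  \<open>a * \<alpha> / 2 - (a + 1) * \<gamma>\<close>, which is negative.\<close>

lemma holder_interpolation:
  assumes hold: "locally_holder f \<gamma> N" and TN: "T + 1 \<le> N" and a: "0 < a"
    and \<gamma>: "a * \<alpha> / 2 < (a + 1) * \<gamma>" and \<eta>: "0 < \<eta>"
  shows "\<forall>\<^sub>F \<epsilon> in at_right 0. \<forall>t\<in>{0..T}.
    \<bar>scaled_increment \<alpha> f \<epsilon> t
      - (power_grid a (grid_index a \<epsilon>) / \<epsilon>) powr (\<alpha> / 2)
        * scaled_increment \<alpha> f (power_grid a (grid_index a \<epsilon>)) t\<bar> \<le> \<eta>"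
proof -
  from hold obtain C0 h0 where h0: "0 < h0"
    and C0: "\<And>h s t. 0 < h \<Longrightarrow> h \<le> h0 \<Longrightarrow> s \<in> {0..<N} \<Longrightarrow> t \<in> {0..<N} \<Longrightarrow> \<bar>s - t\<bar> \<le> h \<Longrightarrow>
      \<bar>f s - f t\<bar> \<le> C0 * h powr \<gamma>"
    unfolding locally_holder_def by metis
  define y where "y \<epsilon> = \<epsilon> powr (- 1 / a)" for \<epsilon> :: real
  define h where "h \<epsilon> = a * (y \<epsilon> / 2) powr (- a - 1)" for \<epsilon>
  have y_lim: "filterlim y at_top (at_right 0)"
    unfolding y_def[abs_def] by (rule powr_neg_filterlim[OF a])
  have half_lim: "filterlim (\<lambda>\<epsilon>. y \<epsilon> / 2) at_top (at_right 0)"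
    using filterlim_tendsto_pos_mult_at_top[OF tendsto_const _ y_lim, of "1/2"] by simp
  have "(h \<longlongrightarrow> a * 0) (at_right 0)"
    unfolding h_def[abs_def] using a
    by (intro tendsto_intros tendsto_neg_powr[OF _ half_lim]) auto
  \<comment> \<open>The bound \<open>1 / 2\<close>, together with \<open>\<epsilon> < 1 / 2\<close>,
    keeps \<open>t + e\<close> below \<open>T + 1\<close> and thus inside the Hoelder
    interval.\<close>
  then have h_ev: "\<forall>\<^sub>F \<epsilon> in at_right 0. h \<epsilon> < min h0 (1 / 2)"
    using h0 by (intro order_tendstoD(2)) auto
  have "((\<lambda>\<epsilon>. \<bar>C0\<bar> * (a powr \<gamma> * 2 powr ((a + 1) * \<gamma>)) * y \<epsilon> powr (a * \<alpha> / 2 - (a + 1) * \<gamma>)) \<longlongrightarrow>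
      \<bar>C0\<bar> * (a powr \<gamma> * 2 powr ((a + 1) * \<gamma>)) * 0) (at_right 0)"
    using \<gamma> by (intro tendsto_intros tendsto_neg_powr[OF _ y_lim]) auto
  then have small: "\<forall>\<^sub>F \<epsilon> in at_right 0.
      \<bar>C0\<bar> * (a powr \<gamma> * 2 powr ((a + 1) * \<gamma>)) * y \<epsilon> powr (a * \<alpha> / 2 - (a + 1) * \<gamma>) < \<eta>"
    using \<eta> by (intro order_tendstoD(2)) auto
  have ev: "\<forall>\<^sub>F \<epsilon> in at_right 0. 2 \<le> y \<epsilon>" using y_lim by (simp add: filterlim_at_top)
  have pos: "\<forall>\<^sub>F \<epsilon> in at_right (0::real). 0 < \<epsilon> \<and> \<epsilon> < 1 / 2"
    using eventually_at_right[of 0 "1/2::real"] by (auto intro: exI[of _ "1/2"])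
  show ?thesis using ev pos h_ev small
  proof eventually_elim
    case (elim \<epsilon>)
    define e where "e = power_grid a (grid_index a \<epsilon>)"
    have e: "\<epsilon> \<le> e" "e - \<epsilon> \<le> h \<epsilon>" "0 < \<epsilon>"
      using power_grid_index(1,2)[OF a, of \<epsilon>] elim by (auto simp: e_def h_def y_def)
    have hpos: "0 < h \<epsilon>" using elim a by (auto simp: h_def)
    show ?case
    proof
      fix t assume t: "t \<in> {0..T}"
      have "\<bar>f (t + \<epsilon>) - f (t + e)\<bar> \<le> C0 * h \<epsilon> powr \<gamma>"
        using e elim t hpos TN by (intro C0) auto
      also have "\<dots> \<le> \<bar>C0\<bar> * h \<epsilon> powr \<gamma>" by (intro mult_right_mono) auto
      finally have 1: "\<bar>f (t + \<epsilon>) - f (t + e)\<bar> \<le> \<bar>C0\<bar> * h \<epsilon> powr \<gamma>" .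
      have ye: "\<epsilon> = y \<epsilon> powr - a" using a e by (simp add: y_def powr_powr)
      have "(e / \<epsilon>) powr (\<alpha> / 2) * e powr (- \<alpha> / 2) = \<epsilon> powr (- \<alpha> / 2)"
        using e by (simp add: powr_divide powr_minus field_simps)
      then have "scaled_increment \<alpha> f \<epsilon> t - (e / \<epsilon>) powr (\<alpha> / 2) * scaled_increment \<alpha> f e t
          = \<epsilon> powr (- \<alpha> / 2) * (f (t + \<epsilon>) - f (t + e))"
        unfolding scaled_increment_def by (simp only: mult.assoc[symmetric]) (simp add: algebra_simps)
      then have "\<bar>scaled_increment \<alpha> f \<epsilon> t - (e / \<epsilon>) powr (\<alpha> / 2) * scaled_increment \<alpha> f e t\<bar>
          \<le> \<epsilon> powr (- \<alpha> / 2) * (\<bar>C0\<bar> * h \<epsilon> powr \<gamma>)"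
        using 1 by (simp add: abs_mult mult_left_mono)
      also have "\<dots> = \<bar>C0\<bar> * (a powr \<gamma> * 2 powr ((a + 1) * \<gamma>)) * y \<epsilon> powr (a * \<alpha> / 2 - (a + 1) * \<gamma>)"
      proof -
        have "\<epsilon> powr (- \<alpha> / 2) = y \<epsilon> powr (a * \<alpha> / 2)"
          by (subst ye) (simp add: powr_powr)
        moreover have "h \<epsilon> powr \<gamma> = a powr \<gamma> * (y \<epsilon> powr (- ((a + 1) * \<gamma>)) * 2 powr ((a + 1) * \<gamma>))"
        proof -
          have "h \<epsilon> powr \<gamma> = a powr \<gamma> * (y \<epsilon> / 2) powr (- ((a + 1) * \<gamma>))"
          proof -
            have "(- a - 1) * \<gamma> = - ((a + 1) * \<gamma>)" by (simp add: algebra_simps)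
            then show ?thesis using a elim by (simp add: h_def powr_mult powr_powr)
          qed
          also have "(y \<epsilon> / 2) powr (- ((a + 1) * \<gamma>)) = y \<epsilon> powr (- ((a + 1) * \<gamma>)) * 2 powr ((a + 1) * \<gamma>)"
            using elim by (simp only: powr_divide powr_minus) (simp add: field_simps)
          finally show ?thesis .
        qed
        moreover have "y \<epsilon> powr (a * \<alpha> / 2 - (a + 1) * \<gamma>) = y \<epsilon> powr (a * \<alpha> / 2) * y \<epsilon> powr (- ((a + 1) * \<gamma>))"
          by (simp flip: powr_add)
        ultimately show ?thesis by (simp only: mult_ac)
      qed
      also have "\<dots> \<le> \<eta>" using elim by simp
      finally show "\<bar>scaled_increment \<alpha> f \<epsilon> t - (power_grid a (grid_index a \<epsilon>) / \<epsilon>) powr (\<alpha> / 2)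
        * scaled_increment \<alpha> f (power_grid a (grid_index a \<epsilon>)) t\<bar> \<le> \<eta>"
        by (simp add: e_def)
    qed
  qed
qed

lemma scaled_increment_sublevel_measurable:
  assumes "continuous_on {0..} f" "0 < \<epsilon>" "S \<in> sets borel" "S \<subseteq> {0..}"
  shows "{t \<in> S. scaled_increment \<alpha> f \<epsilon> t \<le> x} \<in> sets borel"
proof -
  have "continuous_on UNIV (\<lambda>t. scaled_increment \<alpha> f \<epsilon> (max 0 t))"
    unfolding scaled_increment_def using assms(2)
    by (intro continuous_intros continuous_on_compose2[OF assms(1)]) auto
  then have [measurable]: "(\<lambda>t. scaled_increment \<alpha> f \<epsilon> (max 0 t)) \<in> borel_measurable borel"
    by (rule borel_measurable_continuous_onI)
  note assms(3)[measurable]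
  have "{t \<in> S. scaled_increment \<alpha> f \<epsilon> t \<le> x} = S \<inter> {t \<in> space borel. scaled_increment \<alpha> f \<epsilon> (max 0 t) \<le> x}"
    using assms(4) by (auto simp: max_absorb2 subset_iff)
  also have "\<dots> \<in> sets borel" by measurable
  finally show ?thesis .
qed

text \<open>The sublevel set at \<epsilon> is sandwiched between those at the grid point with levels
  \<open>x - 2 * \<eta>\<close> and \<open>x + 2 * \<eta>\<close>. One \<eta> absorbs the
  interpolation error, the other the rescaling factor, which tends to 1. Continuity of
  \<open>g\<close> at \<open>x\<close> closes the gap.\<close>

lemma sublevel_measure_interpolation:
  fixes f :: "real \<Rightarrow> real" and g :: "real \<Rightarrow> real"
  assumes cont: "continuous_on {0..} f"
    and hold: "locally_holder f \<gamma> N" and TN: "T + 1 \<le> N" and a: "0 < a"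
    and \<gamma>: "a * \<alpha> / 2 < (a + 1) * \<gamma>"
    and lim: "\<And>x. (\<lambda>n. measure lborel {t \<in> {0..T}. scaled_increment \<alpha> f (power_grid a n) t \<le> x}) \<longlonglongrightarrow> g x"
    and g: "isCont g x"
  shows "((\<lambda>\<epsilon>. measure lborel {t \<in> {0..T}. scaled_increment \<alpha> f \<epsilon> t \<le> x}) \<longlongrightarrow> g x) (at_right 0)"
proof (rule tendstoI)
  fix \<kappa> :: real assume "0 < \<kappa>"
  let ?Z = "scaled_increment \<alpha> f" and ?e = "\<lambda>\<epsilon>. power_grid a (grid_index a \<epsilon>)"
  let ?F = "\<lambda>\<epsilon> x. measure lborel {t \<in> {0..T}. ?Z \<epsilon> t \<le> x}"
  obtain d where d: "0 < d" "\<And>y. \<bar>y - x\<bar> < d \<Longrightarrow> \<bar>g y - g x\<bar> < \<kappa> / 2"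
    using g \<open>0 < \<kappa>\<close> unfolding continuous_at_eps_delta dist_real_def by (metis half_gt_zero)
  define \<eta> where "\<eta> = d / 3"
  have \<eta>: "0 < \<eta>" "2 * \<eta> < d" using d by (auto simp: \<eta>_def)
  have near: "\<forall>\<^sub>F \<epsilon> in at_right 0. dist (?F (?e \<epsilon>) y) (g y) < \<kappa> / 2" for y
    using filterlim_compose[OF lim grid_index_at_top[OF a]] \<open>0 < \<kappa>\<close> by (intro tendstoD) auto
  have ratio: "((\<lambda>\<epsilon>. (?e \<epsilon> / \<epsilon>) powr (\<alpha> / 2)) \<longlongrightarrow> 1) (at_right 0)"
    using tendsto_powr[OF power_grid_index_ratio[OF a] tendsto_const, of "\<alpha> / 2"] by simp
  have up: "\<forall>\<^sub>F \<epsilon> in at_right 0. x + \<eta> < (?e \<epsilon> / \<epsilon>) powr (\<alpha> / 2) * (x + 2 * \<eta>)"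
    using tendsto_mult_right[OF ratio, of "x + 2 * \<eta>"] \<eta> by (intro order_tendstoD(1)) auto
  have low: "\<forall>\<^sub>F \<epsilon> in at_right 0. (?e \<epsilon> / \<epsilon>) powr (\<alpha> / 2) * (x - 2 * \<eta>) < x - \<eta>"
    using tendsto_mult_right[OF ratio, of "x - 2 * \<eta>"] \<eta> by (intro order_tendstoD(2)) auto
  have pos: "\<forall>\<^sub>F \<epsilon> in at_right (0::real). 0 < \<epsilon>" by (rule eventually_at_right_less)
  show "\<forall>\<^sub>F \<epsilon> in at_right 0. dist (?F \<epsilon> x) (g x) < \<kappa>"
    using near[of "x + 2 * \<eta>"] near[of "x - 2 * \<eta>"] up low pos holder_interpolation[OF hold TN a \<gamma> \<eta>(1)]
  proof eventually_elim
    case (elim \<epsilon>)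
    define \<rho> where "\<rho> = (?e \<epsilon> / \<epsilon>) powr (\<alpha> / 2)"
    have \<rho>: "0 < \<rho>" using elim power_grid_pos[of a "grid_index a \<epsilon>"] by (simp add: \<rho>_def)
    have close: "\<bar>?Z \<epsilon> t - \<rho> * ?Z (?e \<epsilon>) t\<bar> \<le> \<eta>" if "t \<in> {0..T}" for t
      using elim(6) that unfolding \<rho>_def by blast
    have meas: "{t \<in> {0..T}. ?Z \<delta> t \<le> y} \<in> sets lborel" if "0 < \<delta>" for \<delta> y
      using scaled_increment_sublevel_measurable[OF cont that, of "{0..T}"] by simp
    have fin: "{t \<in> {0..T}. ?Z \<delta> t \<le> y} \<in> fmeasurable lborel" if "0 < \<delta>" for \<delta> y
      by (rule fmeasurableI2[where A = "{0..T}"])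
        (use meas[OF that] in \<open>auto simp: fmeasurable_def emeasure_lborel_Icc_eq\<close>)
    have "?Z (?e \<epsilon>) t \<le> x + 2 * \<eta>" if "t \<in> {0..T}" "?Z \<epsilon> t \<le> x" for t
    proof -
      have "\<rho> * ?Z (?e \<epsilon>) t \<le> \<rho> * (x + 2 * \<eta>)"
        using close[OF that(1)] that(2) elim(3) unfolding \<rho>_def[symmetric] by linarith
      then show ?thesis using \<rho> by simp
    qed
    then have 1: "?F \<epsilon> x \<le> ?F (?e \<epsilon>) (x + 2 * \<eta>)"
      by (intro measure_mono_fmeasurable fin power_grid_pos meas elim(5)) auto
    have "?Z \<epsilon> t \<le> x" if "t \<in> {0..T}" "?Z (?e \<epsilon>) t \<le> x - 2 * \<eta>" for t
    proof -
      have "\<rho> * ?Z (?e \<epsilon>) t \<le> \<rho> * (x - 2 * \<eta>)" using \<rho> that by simp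
      then show ?thesis
        using close[OF that(1)] elim(4) unfolding \<rho>_def[symmetric] by linarith
    qed
    then have 2: "?F (?e \<epsilon>) (x - 2 * \<eta>) \<le> ?F \<epsilon> x"
      by (intro measure_mono_fmeasurable fin power_grid_pos meas elim(5)) auto
    have "\<bar>g (x + 2 * \<eta>) - g x\<bar> < \<kappa> / 2" "\<bar>g (x - 2 * \<eta>) - g x\<bar> < \<kappa> / 2"
      using \<eta> by (intro d(2); simp)+
    then show ?case using 1 2 elim(1,2) unfolding dist_real_def by linarith
  qed
qed

section \<open>Arbitrary intervals and the grey case\<close>

text \<open>Supplies the equi-Lipschitz hypothesis that carries convergence from rational to real
  end points.\<close>

lemma sublevel_measure_lipschitz:
  assumes meas: "\<And>u v :: real. {t \<in> {u..v}. P t} \<in> sets borel"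
  shows "\<bar>measure lborel {t \<in> {0..u}. P t} - measure lborel {t \<in> {0..v}. P t}\<bar> \<le> \<bar>u - v\<bar>"
proof -
  have fin: "{t \<in> {u..v}. P t} \<in> fmeasurable lborel" "{u..v} \<in> fmeasurable lborel" for u v
  proof -
    show *: "{u..v} \<in> fmeasurable lborel" by (simp add: fmeasurable_def emeasure_lborel_Icc_eq)
    show "{t \<in> {u..v}. P t} \<in> fmeasurable lborel"
      by (rule fmeasurableI2[OF *]) (use meas in auto)
  qed
  have *: "measure lborel {t \<in> {0..u}. P t} \<le> measure lborel {t \<in> {0..v}. P t} \<and>
      measure lborel {t \<in> {0..v}. P t} \<le> measure lborel {t \<in> {0..u}. P t} + (v - u)" if "u \<le> v" for u v
  proof
    show "measure lborel {t \<in> {0..u}. P t} \<le> measure lborel {t \<in> {0..v}. P t}"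
      using that by (intro measure_mono_fmeasurable fin fmeasurableD) auto
    have "measure lborel {t \<in> {0..v}. P t} \<le> measure lborel ({t \<in> {0..u}. P t} \<union> {u..v})"
      by (intro measure_mono_fmeasurable fin fmeasurableD fmeasurable.Un) auto
    also have "\<dots> \<le> measure lborel {t \<in> {0..u}. P t} + measure lborel {u..v}"
      by (intro measure_Un_le fmeasurableD fin)
    finally show "measure lborel {t \<in> {0..v}. P t} \<le> measure lborel {t \<in> {0..u}. P t} + (v - u)"
      using that by simp
  qed
  show ?thesis using *[of u v] *[of v u] by (cases "u \<le> v") auto
qed

lemma emeasure_lebesgue: "S \<in> sets borel \<Longrightarrow> emeasure lebesgue S = emeasure lborel S"
  by simp

text \<open>Bounded intervals agree up to end points with a half-open one, whose sublevel measure is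
  a difference of two over \<open>{0..T}\<close>. Unbounded ones have infinite limit, because
  sufficiently long bounded pieces already exceed any constant.\<close>

lemma sublevel_interval_conv:
  fixes P :: "real \<Rightarrow> real \<Rightarrow> bool"
  assumes meas: "\<And>\<epsilon> S. 0 < \<epsilon> \<Longrightarrow> S \<in> sets borel \<Longrightarrow> S \<subseteq> {0..} \<Longrightarrow> {t \<in> S. P \<epsilon> t} \<in> sets borel"
    and lim: "\<And>T. 0 \<le> T \<Longrightarrow> ((\<lambda>\<epsilon>. measure lborel {t \<in> {0..T}. P \<epsilon> t}) \<longlongrightarrow> T * c) (at_right 0)"
    and c: "0 < c" and I: "is_interval I" "I \<subseteq> {0..}"
  shows "((\<lambda>\<epsilon>. emeasure lebesgue {t \<in> I. P \<epsilon> t}) \<longlongrightarrow> emeasure lebesgue I * ennreal c) (at_right 0)"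
proof -
  have pos: "\<forall>\<^sub>F \<epsilon> in at_right (0::real). 0 < \<epsilon>" by (rule eventually_at_right_less)
  have Ioc: "((\<lambda>\<epsilon>. measure lborel {t \<in> {a<..b}. P \<epsilon> t}) \<longlongrightarrow> (b - a) * c) (at_right 0)"
    if ab: "0 \<le> a" "a \<le> b" for a b
  proof (rule Lim_transform_eventually)
    show "((\<lambda>\<epsilon>. measure lborel {t \<in> {0..b}. P \<epsilon> t} - measure lborel {t \<in> {0..a}. P \<epsilon> t}) \<longlongrightarrow> (b - a) * c) (at_right 0)"
      using tendsto_diff[OF lim[of b] lim[of a]] ab by (simp add: left_diff_distrib)
    show "\<forall>\<^sub>F \<epsilon> in at_right 0. measure lborel {t \<in> {0..b}. P \<epsilon> t} - measure lborel {t \<in> {0..a}. P \<epsilon> t}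
        = measure lborel {t \<in> {a<..b}. P \<epsilon> t}"
      using pos
    proof eventually_elim
      case (elim \<epsilon>)
      have s: "{t \<in> {0..u}. P \<epsilon> t} \<in> sets lborel" for u using meas[OF elim, of "{0..u}"] by simp
      have "emeasure lborel {t \<in> {0..b}. P \<epsilon> t} \<le> emeasure lborel {0..b}"
        by (intro emeasure_mono) auto
      then have "emeasure lborel {t \<in> {0..b}. P \<epsilon> t} \<noteq> \<infinity>"
        using ab by (auto simp: top_unique)
      then have "measure lborel ({t \<in> {0..b}. P \<epsilon> t} - {t \<in> {0..a}. P \<epsilon> t})
          = measure lborel {t \<in> {0..b}. P \<epsilon> t} - measure lborel {t \<in> {0..a}. P \<epsilon> t}"
        using ab by (intro measure_Diff s) auto
      moreover have "{t \<in> {0..b}. P \<epsilon> t} - {t \<in> {0..a}. P \<epsilon> t} = {t \<in> {a<..b}. P \<epsilon> t}"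
        using ab by auto
      ultimately show ?case by simp
    qed
  qed
  have em: "emeasure lborel {t \<in> {a<..b}. P \<epsilon> t} = ennreal (measure lborel {t \<in> {a<..b}. P \<epsilon> t})" for a b \<epsilon>
  proof -
    have "emeasure lborel {t \<in> {a<..b}. P \<epsilon> t} \<le> emeasure lborel {a<..b}"
      by (intro emeasure_mono) auto
    also have "\<dots> < top" by (cases "a \<le> b") auto
    finally show ?thesis by (intro emeasure_eq_ennreal_measure) auto
  qed
  have bounded: ?thesis if I': "{a<..<b} \<subseteq> I" "I \<subseteq> {a..b}" and [measurable]: "I \<in> sets borel" for a b
  proof (cases "a < b")
    case True
    have a: "0 \<le> a"
    proof (rule ccontr)
      assume "\<not> 0 \<le> a"
      \<comment> \<open>A negative point of the open interval, contradicting that \<open>I\<close>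
        lies in the half-line.\<close>
      then have "(a + min b 0) / 2 \<in> {a<..<b}" "(a + min b 0) / 2 < 0" using True by auto
      with subsetD[OF subset_trans[OF I'(1) I(2)], of "(a + min b 0) / 2"] show False by simp
    qed
    have ae: "AE t in lborel. t \<in> I \<longleftrightarrow> t \<in> {a<..b}"
      using AE_lborel_singleton[of a] AE_lborel_singleton[of b]
    proof eventually_elim
      case (elim t)
      have "t \<in> I \<Longrightarrow> t \<in> {a..b}" "t \<in> {a<..<b} \<Longrightarrow> t \<in> I" using I' by blast+
      with elim show ?case by auto
    qed
    have "emeasure lebesgue I = emeasure lborel {a<..b}"
      using ae by (auto intro!: emeasure_eq_AE)
    then have I_eq: "emeasure lebesgue I = ennreal (b - a)" using True by simp
    have "((\<lambda>\<epsilon>. ennreal (measure lborel {t \<in> {a<..b}. P \<epsilon> t})) \<longlongrightarrow> ennreal ((b - a) * c)) (at_right 0)"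
      using a True by (intro tendsto_ennrealI Ioc) auto
    moreover have "\<forall>\<^sub>F \<epsilon> in at_right 0. ennreal (measure lborel {t \<in> {a<..b}. P \<epsilon> t}) = emeasure lebesgue {t \<in> I. P \<epsilon> t}"
      using pos
    proof eventually_elim
      case (elim \<epsilon>)
      have ms: "{t \<in> I. P \<epsilon> t} \<in> sets borel" "{t \<in> {a<..b}. P \<epsilon> t} \<in> sets borel"
        using a by (intro meas[OF elim] I(2) \<open>I \<in> sets borel\<close>; auto)+
      have "emeasure lborel {t \<in> I. P \<epsilon> t} = emeasure lborel {t \<in> {a<..b}. P \<epsilon> t}"
      proof (rule emeasure_eq_AE)
        show "AE t in lborel. t \<in> {t \<in> I. P \<epsilon> t} \<longleftrightarrow> t \<in> {t \<in> {a<..b}. P \<epsilon> t}"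
          using ae by eventually_elim auto
      qed (simp_all only: sets_lborel ms)
      then show ?case using ms by (simp only: em emeasure_lebesgue)
    qed
    ultimately have "((\<lambda>\<epsilon>. emeasure lebesgue {t \<in> I. P \<epsilon> t}) \<longlongrightarrow> ennreal ((b - a) * c)) (at_right 0)"
      by (rule Lim_transform_eventually)
    then show ?thesis
      unfolding I_eq using True c by (simp add: ennreal_mult)
  next
    case False
    then have "I \<subseteq> {a}" using I' by auto
    then have "emeasure lborel I \<le> emeasure lborel {a}" by (intro emeasure_mono) auto
    then have 0: "I \<in> null_sets lborel" by (auto simp: null_sets_def)
    have "emeasure lebesgue {t \<in> I. P \<epsilon> t} = 0" for \<epsilon>
      using null_sets_completion_subset[OF _ null_sets_completionI[OF 0], of "{t \<in> I. P \<epsilon> t}"] by auto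
    moreover have "emeasure lebesgue I = 0" using null_sets_completionI[OF 0] by auto
    ultimately show ?thesis by simp
  qed
  have unbounded: ?thesis if I': "{a<..} \<subseteq> I" and [measurable]: "I \<in> sets borel" for a
  proof -
    define a' where "a' = max a 0"
    have a': "0 \<le> a'" "{a'<..} \<subseteq> I" using I' by (auto simp: a'_def)
    have big: "\<forall>\<^sub>F \<epsilon> in at_right 0. ennreal K < emeasure lebesgue {t \<in> I. P \<epsilon> t}" if "0 \<le> K" for K
    proof -
      \<comment> \<open>The limit over \<open>{a'<..b}\<close> is \<open>(b - a') * c\<close>, that
        is \<open>K + 1\<close>.\<close>
      define b where "b = a' + (K + 1) / c"
      have b: "a' \<le> b" "K < (b - a') * c" using c that by (auto simp: b_def)
      have "\<forall>\<^sub>F \<epsilon> in at_right 0. K < measure lborel {t \<in> {a'<..b}. P \<epsilon> t}"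
        by (rule order_tendstoD(1)[OF Ioc[OF a'(1) b(1)] b(2)])
      then show ?thesis using pos
      proof eventually_elim
        case (elim \<epsilon>)
        have [measurable]: "{t \<in> I. P \<epsilon> t} \<in> sets borel"
          using meas[OF elim(2)] I by auto
        have "ennreal K < emeasure lborel {t \<in> {a'<..b}. P \<epsilon> t}"
          unfolding em using elim(1) that by (intro ennreal_lessI) auto
        also have "\<dots> \<le> emeasure lborel {t \<in> I. P \<epsilon> t}"
          using a' by (intro emeasure_mono) auto
        finally show ?case by simp
      qed
    qed
    have "emeasure lebesgue I = top"
    proof -
      have "ennreal K \<le> emeasure lborel I" if "0 \<le> K" for K
      proof -
        have "ennreal K = emeasure lborel {a'<..a' + K}" using that by simp
        also have "\<dots> \<le> emeasure lborel I" using a' by (intro emeasure_mono) auto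
        finally show ?thesis .
      qed
      then have "emeasure lborel I \<noteq> ennreal r" if "0 \<le> r" for r
        using that by (metis add_nonneg_nonneg ennreal_le_iff less_add_one not_less zero_le_one)
      then have "emeasure lborel I = top" by (cases "emeasure lborel I" rule: ennreal_cases) auto
      then show ?thesis by simp
    qed
    then have "emeasure lebesgue I * ennreal c = top" using c by (simp add: ennreal_top_mult)
    then show ?thesis by (simp only: tendsto_top_iff_ennreal) (use big in blast)
  qed
  from is_real_interval[OF I(1)] obtain a b where
    ab: "I = {} \<or> I = UNIV \<or> I = {..<b} \<or> I = {..b} \<or> I = {a<..} \<or> I = {a..} \<or>
      I = {a<..<b} \<or> I = {a<..b} \<or> I = {a..<b} \<or> I = {a..b}"
    by (elim exE)
  \<comment> \<open>This negative point belongs to every interval unbounded below with the end point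
    \<open>b\<close>, so those shapes are excluded.\<close>
  have "min b 0 - 1 \<notin> I" using I(2) by auto
  then have "\<not> (I = UNIV \<or> I = {..<b} \<or> I = {..b})" by auto
  with ab consider "I = {}" | "I = {a<..} \<or> I = {a..}"
    | "I = {a<..<b} \<or> I = {a<..b} \<or> I = {a..<b} \<or> I = {a..b}"
    by argo
  then show ?thesis
  proof cases
    case 1
    then show ?thesis by simp
  next
    case 2
    then show ?thesis by (intro unbounded[of a]) auto
  next
    case 3
    then show ?thesis by (intro bounded[of a b]) auto
  qed
qed

section \<open>Gaussian distribution functions and the passage to the grey process\<close>

lemma centered_gaussian_cdf_scale:
  assumes "0 < v"
  shows "centered_gaussian_cdf v x = cdf std_normal_distribution (x / sqrt v)"
proof -
  have "{y. sqrt v * y \<le> x} = {..x / sqrt v}"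
    using assms by (auto simp: field_simps)
  then show ?thesis
    using assms unfolding centered_gaussian_cdf_def gaussian_law_eq_distr[OF less_imp_le[OF assms]] cdf_def
    by (subst measure_distr) (auto simp: vimage_def)
qed

lemma centered_gaussian_cdf_0: "centered_gaussian_cdf 0 x = indicator {0..} x"
  by (simp add: centered_gaussian_cdf_def gaussian_law_def cdf_def measure_return indicator_def)

lemma (in fbm) normalized_increment_eq: "Z \<epsilon> t \<omega> = scaled_increment \<alpha> (\<lambda>t. B t \<omega>) \<epsilon> t"
  by (simp add: normalized_increment_def scaled_increment_def)

lemma (in fbm) AE_increment_measure_conv:
  "AE \<omega> in M. \<forall>T\<ge>0. \<forall>x. ((\<lambda>\<epsilon>. measure lborel {t \<in> {0..T}. Z \<epsilon> t \<omega> \<le> x})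
    \<longlongrightarrow> T * cdf std_normal_distribution x) (at_right 0)"
proof -
  \<comment> \<open>The least exponent meeting both summability conditions.\<close>
  define a where "a = max 4 (4 / (2 - \<alpha>))"
  have a: "4 \<le> a" "4 \<le> a * (2 - \<alpha>)"
    using \<alpha> by (auto simp: a_def max_def field_simps)
  \<comment> \<open>Chosen so that \<open>(a + 1) * \<gamma>\<close> equals
    \<open>\<alpha> / 2 * (a + 1 / 2)\<close>, halfway between \<open>a * \<alpha> / 2\<close> and
    \<open>(a + 1) * \<alpha> / 2\<close>: the first is the interpolation condition, the second the
    Hoelder limit.\<close>
  define \<gamma> where "\<gamma> = \<alpha> / 2 * ((a + 1 / 2) / (a + 1))"
  have \<gamma>: "0 < \<gamma>" "\<gamma> < \<alpha> / 2" "a * \<alpha> / 2 < (a + 1) * \<gamma>"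
    using \<alpha> a by (auto simp: \<gamma>_def field_simps intro!: add_pos_pos mult_pos_pos)
  show ?thesis
    using AE_increment_measure_conv_on_grid[OF a] AE_holder[OF \<gamma>(1,2)] AE_space
  proof eventually_elim
    case (elim \<omega>)
    let ?f = "\<lambda>t. B t \<omega>"
    let ?\<Phi> = "cdf std_normal_distribution"
    let ?S = "\<lambda>n x. {t. scaled_increment \<alpha> ?f (power_grid a n) (max 0 t) \<le> x}"
    have cont: "continuous_on {0..} ?f" using elim(3) by (rule continuous_B)
    have S[measurable]: "?S n x \<in> sets borel" for n x
    proof -
      have "(\<lambda>t. Z (power_grid a n) (max 0 t) \<omega>) \<in> borel_measurable borel"
        by (intro borel_measurable_continuous_onI continuous_Z elim(3) power_grid_pos)
      then have "{t \<in> space borel. scaled_increment \<alpha> ?f (power_grid a n) (max 0 t) \<le> x} \<in> sets borel"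
        unfolding normalized_increment_eq by measurable
      then show ?thesis by simp
    qed
    \<comment> \<open>The extension lemma ranges over all real \<open>T\<close>; for negative
      \<open>T\<close> the time interval is empty, and \<open>max 0 T\<close> continues the limit
      continuously.\<close>
    have grid: "(\<lambda>n. measure lborel {t \<in> {0..T}. t \<in> ?S n x}) \<longlonglongrightarrow> max 0 T * ?\<Phi> x" for T x
    proof (rule LIMSEQ_of_dense_equi_lipschitz[where L = 1 and u = T and g = "\<lambda>T. max 0 T * ?\<Phi> x"
          and f = "\<lambda>n T. measure lborel {t \<in> {0..T}. t \<in> ?S n x}"])
      fix q :: real assume q: "q \<in> \<rat>"
      show "(\<lambda>n. measure lborel {t \<in> {0..q}. t \<in> ?S n x}) \<longlonglongrightarrow> max 0 q * ?\<Phi> x"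
      proof (cases "0 < q")
        case True
        have "measure lborel {t \<in> {0..q}. t \<in> ?S n x} = q * measure (uniform_on q) {t. Z (power_grid a n) (max 0 t) \<omega> \<le> x}" for n
          using True unfolding normalized_increment_eq
          by (subst measure_uniform_measure) (auto simp: Int_def)
        with elim(1) q True show ?thesis by (auto intro!: tendsto_intros)
      next
        case False
        then have "{t \<in> {0..q}. t \<in> ?S n x} \<subseteq> {0}" for n by auto
        then have "measure lborel {t \<in> {0..q}. t \<in> ?S n x} = 0" for n
          by (metis (no_types, lifting) finite.emptyI finite.insertI finite_subset finite_imp_null_set_lborel measure_eq_0_null_sets)
        with False show ?thesis by simp
      qed
    next
      have "{t \<in> {u..v}. t \<in> ?S n x} \<in> sets borel" for u v n
      proof -
        have "{t \<in> {u..v}. t \<in> ?S n x} = {u..v} \<inter> ?S n x" by auto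
        then show ?thesis by simp
      qed
      then show "\<forall>\<^sub>F n in sequentially. \<forall>u v. \<bar>measure lborel {t \<in> {0..u}. t \<in> ?S n x} - measure lborel {t \<in> {0..v}. t \<in> ?S n x}\<bar> \<le> 1 * \<bar>u - v\<bar>"
        using sublevel_measure_lipschitz[of "\<lambda>t. t \<in> ?S n x" for n] by (intro always_eventually allI) simp
      show "isCont (\<lambda>T. max 0 T * ?\<Phi> x) T" by (intro continuous_intros)
    qed simp
    show ?case
    proof (intro allI impI)
      fix T x :: real assume T: "0 \<le> T"
      obtain N :: nat where N: "T + 1 \<le> real N" using real_arch_simple by blast
      have "((\<lambda>\<epsilon>. measure lborel {t \<in> {0..T}. scaled_increment \<alpha> ?f \<epsilon> t \<le> x}) \<longlongrightarrow> T * ?\<Phi> x) (at_right 0)"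
      proof (rule sublevel_measure_interpolation[OF cont _ N _ \<gamma>(3)])
        show "locally_holder ?f \<gamma> (real N)" using elim(2) by blast
        show "0 < a" using a by simp
        show "(\<lambda>n. measure lborel {t \<in> {0..T}. scaled_increment \<alpha> ?f (power_grid a n) t \<le> y}) \<longlonglongrightarrow> T * ?\<Phi> y" for y
        proof -
          have "{t \<in> {0..T}. t \<in> ?S n y} = {t \<in> {0..T}. scaled_increment \<alpha> ?f (power_grid a n) t \<le> y}" for n
            by (auto simp: max_absorb2)
          with grid[of T y] T show ?thesis by simp
        qed
        show "isCont (\<lambda>y. T * ?\<Phi> y) x"
          by (intro continuous_intros isCont_cdf_std_normal)
      qed
      then show "((\<lambda>\<epsilon>. measure lborel {t \<in> {0..T}. Z \<epsilon> t \<omega> \<le> x}) \<longlongrightarrow> T * ?\<Phi> x) (at_right 0)"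
        by (simp add: normalized_increment_eq)
    qed
  qed
qed

lemma grey_normalized_increment:
  "normalized_increment \<alpha> (grey_brownian_motion Y B) \<epsilon> t \<omega> = sqrt (Y \<omega>) * normalized_increment \<alpha> B \<epsilon> t \<omega>"
  by (simp add: normalized_increment_def grey_brownian_motion_def algebra_simps)

theorem theorem5:
  fixes M :: "'a measure"
    and \<alpha> \<beta> :: real
    and Y :: "'a \<Rightarrow> real"
    and B :: "real \<Rightarrow> 'a \<Rightarrow> real"
  assumes "prob_space M"
    and "0 < \<alpha>" and "\<alpha> < 2"
    and "0 < \<beta>" and "\<beta> \<le> 1"
    and "M_Wright_variable M \<beta> Y"
    and "fractional_brownian_motion M (\<alpha> / 2) B"
    and "independent_of_process M Y B"
  shows "(AE \<omega> in M. \<forall>t\<in>{0..1}. \<forall>x. x \<noteq> 0 \<longrightarrow>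
            ((\<lambda>\<epsilon>. measure lebesgue
                {s \<in> {0..t}. normalized_increment \<alpha> (grey_brownian_motion Y B) \<epsilon> s \<omega> \<le> x})
              \<longlongrightarrow> t * centered_gaussian_cdf (Y \<omega>) x) (at_right 0)) \<and>
         (AE \<omega> in M. \<forall>I. is_interval I \<and> I \<subseteq> {0..} \<longrightarrow> (\<forall>x.
            ((\<lambda>\<epsilon>. emeasure lebesgue
                {t \<in> I. normalized_increment \<alpha> (grey_brownian_motion Y B) \<epsilon> t \<omega> \<le> x})
              \<longlongrightarrow> emeasure lebesgue I * ennreal (centered_gaussian_cdf (Y \<omega>) x)) (at_right 0)))"
proof -
  interpret fbm M \<alpha> B
    using assms by (simp add: fbm_def fbm_axioms_def)
  let ?N = "normalized_increment \<alpha> (grey_brownian_motion Y B)"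
  have intervals: "AE \<omega> in M. \<forall>I. is_interval I \<and> I \<subseteq> {0..} \<longrightarrow> (\<forall>x.
            ((\<lambda>\<epsilon>. emeasure lebesgue {t \<in> I. ?N \<epsilon> t \<omega> \<le> x})
              \<longlongrightarrow> emeasure lebesgue I * ennreal (centered_gaussian_cdf (Y \<omega>) x)) (at_right 0))"
    using AE_increment_measure_conv AE_space
  proof eventually_elim
    case (elim \<omega>)
    have "0 \<le> Y \<omega>" using assms(6) elim(2) unfolding M_Wright_variable_def by blast
    show ?case
    proof (intro allI impI)
      fix I :: "real set" and x assume "is_interval I \<and> I \<subseteq> {0..}"
      then have I: "is_interval I" "I \<subseteq> {0..}" by simp_all
      show "((\<lambda>\<epsilon>. emeasure lebesgue {t \<in> I. ?N \<epsilon> t \<omega> \<le> x})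
              \<longlongrightarrow> emeasure lebesgue I * ennreal (centered_gaussian_cdf (Y \<omega>) x)) (at_right 0)"
      proof (cases "Y \<omega> = 0")
        \<comment> \<open>The increments vanish identically, so the sublevel set is all of
          \<open>I\<close> or empty, in agreement with the distribution function of the point mass
          at 0.\<close>
        case True
        show ?thesis
          unfolding grey_normalized_increment True centered_gaussian_cdf_0
          by (cases "0 \<le> x") simp_all
      next
        case False
        with \<open>0 \<le> Y \<omega>\<close> have Y: "0 < Y \<omega>" by simp
        have eq: "?N \<epsilon> t \<omega> \<le> x \<longleftrightarrow> Z \<epsilon> t \<omega> \<le> x / sqrt (Y \<omega>)" for \<epsilon> t
          unfolding grey_normalized_increment using Y by (simp add: pos_le_divide_eq mult.commute)
        show ?thesis unfolding eq centered_gaussian_cdf_scale[OF Y]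
        proof (rule sublevel_interval_conv[OF _ _ cdf_std_normal_pos I])
          fix \<epsilon> :: real and S :: "real set" assume "0 < \<epsilon>" "S \<in> sets borel" "S \<subseteq> {0..}"
          then show "{t \<in> S. Z \<epsilon> t \<omega> \<le> x / sqrt (Y \<omega>)} \<in> sets borel"
            unfolding normalized_increment_eq
            by (intro scaled_increment_sublevel_measurable continuous_B elim(2))
        qed (use elim(1) in blast)
      qed
    qed
  qed
  \<comment> \<open>The second claim for \<open>{0..t}\<close>: the limit is finite there, so the
    convergence passes from \<open>emeasure\<close> to \<open>measure\<close>.\<close>
  moreover from intervals have "AE \<omega> in M. \<forall>t\<in>{0..1}. \<forall>x. x \<noteq> 0 \<longrightarrow>
      ((\<lambda>\<epsilon>. measure lebesgue {s \<in> {0..t}. ?N \<epsilon> s \<omega> \<le> x}) \<longlongrightarrow> t * centered_gaussian_cdf (Y \<omega>) x) (at_right 0)"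
  proof eventually_elim
    case (elim \<omega>)
    show ?case
    proof (intro ballI allI impI)
      fix t x :: real assume t: "t \<in> {0..1}"
      have "0 \<le> centered_gaussian_cdf (Y \<omega>) x" by (simp add: centered_gaussian_cdf_def cdf_def)
      have "((\<lambda>\<epsilon>. emeasure lebesgue {s \<in> {0..t}. ?N \<epsilon> s \<omega> \<le> x})
          \<longlongrightarrow> emeasure lebesgue {0..t} * ennreal (centered_gaussian_cdf (Y \<omega>) x)) (at_right 0)"
        by (rule elim[rule_format]) (auto simp: is_interval_cc)
      also have "emeasure lebesgue {0..t} * ennreal (centered_gaussian_cdf (Y \<omega>) x)
          = ennreal (t * centered_gaussian_cdf (Y \<omega>) x)"
        using t \<open>0 \<le> centered_gaussian_cdf (Y \<omega>) x\<close> by (simp add: ennreal_mult)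
      finally show "((\<lambda>\<epsilon>. measure lebesgue {s \<in> {0..t}. ?N \<epsilon> s \<omega> \<le> x})
          \<longlongrightarrow> t * centered_gaussian_cdf (Y \<omega>) x) (at_right 0)"
        unfolding measure_def using t \<open>0 \<le> centered_gaussian_cdf (Y \<omega>) x\<close>
        by (intro tendsto_enn2real) auto
    qed
  qed
  ultimately show ?thesis by blast
qed

end
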